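(* (1) The $\mathbb{S}$-collection of relative simplicial complexes of the form $(K,\{\emptyset\})$ forms a suboperad of $(\mathsf{relscpx},\{\circ_k^\ast\})$ isomorphic to the substitution operad $(\mathsf{scpx}_{\neq\emptyset},\{\circ_k\})$ through the map dropping the second element of the pair. (2) The $\mathbb{S}$-collection of relative simplicial complexes of the form $(\Delta_{[n]},K)$ with $K\neq\emptyset$ forms a suboperad of $(\mathsf{relscpx},\{\circ_k^\ast\})$ isomorphic to the composition operad $(\mathsf{scpx}_{\neq\emptyset},\{\circ_k^c\})$ through the map dropping the first element of the pair.
   Context: For $n\ge1$ let $[n]=\{1,\dots,n\}$. A simplicial complex on $[n]$ is a family of subsets of $[n]$ closed under taking subsets; the empty family $\emptyset$ and $\{\emptyset\}$ are allowed, as are ghost vertices. $\mathsf{scpx}_{\neq\emptyset}(n)$ is the set of simplicial complexes on $[n]$ that are not the empty family. $\Delta_{[n]}$ is the complex of all subsets of $[n]$. A relative simplicial complex on $[n]$ is a pair $(K,L)$ of simplicial complexes on $[n]$ with $L\subseteq K$; $\mathsf{relscpx}(n)$ is the set of these. $\mathbb{S}_n$ acts by relabelling. Put $I^{<k}=\{i\in I\mid i<k\}$, $I^{>k}=\{i\in I\mid i>k\}$, $I+\ell=\{i+\ell\mid i\in I\}$. For $I\subseteq[n]$, $J\subseteq[m]$, $k\in[n]$: $I\circ_kJ=I^{<k}\sqcup(J+k-1)\sqcup(I^{>k}+m-1)$ if $k\in I$, and $I^{<k}\sqcup(I^{>k}+m-1)$ if $k\notin I$; $I\circ_k^cJ=I^{<k}\sqcup([m]+k-1)\sqcup(I^{>k}+m-1)$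 if $k\in I$, and $I^{<k}\sqcup(J+k-1)\sqcup(I^{>k}+m-1)$ if $k\notin I$. Substitution operad: $K\circ_kL=\{I\circ_kJ\mid I\in K,J\in L\}$, unit $\{\emptyset,\{1\}\}$ on $[1]$. Composition operad: $K\circ_k^cL$ is the set of all subsets of the sets $I\circ_k^cJ$, $I\in K,J\in L$, unit $\{\emptyset\}$ on $[1]$. The join of $K_1$ on $[n_1]$ and $K_2$ on $[n_2]$ is $K_1\ast K_2=\{I_1\sqcup(I_2+n_1)\mid I_1\in K_1,I_2\in K_2\}$ on $[n_1+n_2]$. For $K$ on $[n]$, $k\in[n]$ and $(M,N)\in\mathsf{relscpx}(m)$, $K\triangleleft_k^\ast(M,N)=\bigcup_{I\in K}P_1^I\ast\cdots\ast P_n^I$, where for $j\neq k$, $P_j^I=\{\emptyset,\{1\}\}$ if $j\in I$ and $P_j^I=\{\emptyset\}$ (on $[1]$) if $j\notin I$, while $P_k^I=M$ if $k\in I$ and $P_k^I=N$ if $k\notin I$. The operad $(\mathsf{relscpx},\{\circ_k^\ast\})$ has compositions $(K,L)\circ_k^\ast(M,N)=(K\triangleleft_k^\ast(M,N),L\triangleleft_k^\ast(M,N))$ and unit $(\{\emptyset,\{1\}\},\{\emptyset\})$. *)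

theory Defs
  imports "HOL-Combinatorics.Permutations"
begin

section \<open>Symmetric operads in sets\<close>

text \<open>
  Symmetric operads concentrated in arities \<open>n \<ge> 1\<close>, presented by partial compositions.
  The elements of different arities share one type and need not be disjoint, so arities are passed
  explicitly: \<open>ocomp P n m k x y\<close> is \<open>x \<circ>\<^sub>k y\<close> for \<open>x\<close> of arity \<open>n\<close> and \<open>y\<close> of arity \<open>m\<close>. Permutations
  of \<open>[n]\<close> are the functions \<open>\<sigma>\<close> with \<open>\<sigma> permutes {1..n}\<close>. The action is a left action (relabelling
  inputs); the corresponding right action is \<open>x \<cdot> \<sigma> = \<sigma>\<^sup>-\<^sup>1 \<cdot> x\<close>. Nothing is required in arity \<open>0\<close>.
\<close>

record 'a operad =
  elts :: "nat \<Rightarrow> 'a set"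
  oact :: "nat \<Rightarrow> (nat \<Rightarrow> nat) \<Rightarrow> 'a \<Rightarrow> 'a"
  ocomp :: "nat \<Rightarrow> nat \<Rightarrow> nat \<Rightarrow> 'a \<Rightarrow> 'a \<Rightarrow> 'a"
  ounit :: 'a

text \<open>
  When input \<open>k\<close> is replaced by a block of \<open>m\<close> inputs, input \<open>i \<noteq> k\<close> becomes input \<open>outer_pos m k i\<close> and
  input \<open>j\<close> of the block becomes input \<open>j + k - 1\<close>. The permutation \<open>perm_comp m k \<sigma> \<tau>\<close> sends
  \<open>outer_pos m k i\<close> to \<open>outer_pos m (\<sigma> k) (\<sigma> i)\<close> and \<open>j + k - 1\<close> to \<open>\<tau> j + \<sigma> k - 1\<close>.
\<close>

definition outer_pos :: "nat \<Rightarrow> nat \<Rightarrow> nat \<Rightarrow> nat" where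
  "outer_pos m k i = (if i < k then i else i + m - 1)"

definition perm_comp :: "nat \<Rightarrow> nat \<Rightarrow> (nat \<Rightarrow> nat) \<Rightarrow> (nat \<Rightarrow> nat) \<Rightarrow> nat \<Rightarrow> nat" where
  "perm_comp m k \<sigma> \<tau> a =
     (if a < k then outer_pos m (\<sigma> k) (\<sigma> a)
      else if a < k + m then \<tau> (a + 1 - k) + \<sigma> k - 1
      else outer_pos m (\<sigma> k) (\<sigma> (a + 1 - m)))"

locale operad =
  fixes P :: "'a operad"
  assumes act_closed:
      "\<lbrakk>n \<ge> 1; \<sigma> permutes {1..n}; x \<in> elts P n\<rbrakk> \<Longrightarrow> oact P n \<sigma> x \<in> elts P n"
    and act_id:
      "\<lbrakk>n \<ge> 1; x \<in> elts P n\<rbrakk> \<Longrightarrow> oact P n id x = x"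
    and act_comp:
      "\<lbrakk>n \<ge> 1; \<sigma> permutes {1..n}; \<tau> permutes {1..n}; x \<in> elts P n\<rbrakk>
       \<Longrightarrow> oact P n (\<sigma> \<circ> \<tau>) x = oact P n \<sigma> (oact P n \<tau> x)"
    and unit_closed: "ounit P \<in> elts P 1"
    and comp_closed:
      "\<lbrakk>n \<ge> 1; m \<ge> 1; k \<in> {1..n}; x \<in> elts P n; y \<in> elts P m\<rbrakk>
       \<Longrightarrow> ocomp P n m k x y \<in> elts P (n + m - 1)"
    and unit_left:
      "\<lbrakk>n \<ge> 1; x \<in> elts P n\<rbrakk> \<Longrightarrow> ocomp P 1 n 1 (ounit P) x = x"
    and unit_right:
      "\<lbrakk>n \<ge> 1; k \<in> {1..n}; x \<in> elts P n\<rbrakk> \<Longrightarrow> ocomp P n 1 k x (ounit P) = x"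
    and assoc_sequential:
      "\<lbrakk>n \<ge> 1; m \<ge> 1; l \<ge> 1; i \<in> {1..n}; j \<in> {1..m};
        x \<in> elts P n; y \<in> elts P m; z \<in> elts P l\<rbrakk>
       \<Longrightarrow> ocomp P (n + m - 1) l (i + j - 1) (ocomp P n m i x y) z
         = ocomp P n (m + l - 1) i x (ocomp P m l j y z)"
    and assoc_parallel:
      "\<lbrakk>n \<ge> 1; m \<ge> 1; l \<ge> 1; i \<in> {1..n}; j \<in> {1..n}; i < j;
        x \<in> elts P n; y \<in> elts P m; z \<in> elts P l\<rbrakk>
       \<Longrightarrow> ocomp P (n + m - 1) l (j + m - 1) (ocomp P n m i x y) z
         = ocomp P (n + l - 1) m i (ocomp P n l j x z) y"
    and equivariance:
      "\<lbrakk>n \<ge> 1; m \<ge> 1; k \<in> {1..n}; \<sigma> permutes {1..n}; \<tau> permutes {1..m};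
        x \<in> elts P n; y \<in> elts P m\<rbrakk>
       \<Longrightarrow> ocomp P n m (\<sigma> k) (oact P n \<sigma> x) (oact P m \<tau> y)
         = oact P (n + m - 1) (perm_comp m k \<sigma> \<tau>) (ocomp P n m k x y)"

locale suboperad = operad P for P :: "'a operad" +
  fixes Q :: "nat \<Rightarrow> 'a set"
  assumes sub_elts: "n \<ge> 1 \<Longrightarrow> Q n \<subseteq> elts P n"
    and sub_act: "\<lbrakk>n \<ge> 1; \<sigma> permutes {1..n}; x \<in> Q n\<rbrakk> \<Longrightarrow> oact P n \<sigma> x \<in> Q n"
    and sub_unit: "ounit P \<in> Q 1"
    and sub_comp:
      "\<lbrakk>n \<ge> 1; m \<ge> 1; k \<in> {1..n}; x \<in> Q n; y \<in> Q m\<rbrakk> \<Longrightarrow> ocomp P n m k x y \<in> Q (n + m - 1)"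

definition restrict_operad :: "'a operad \<Rightarrow> (nat \<Rightarrow> 'a set) \<Rightarrow> 'a operad" where
  "restrict_operad P Q = P\<lparr>elts := Q\<rparr>"

locale operad_iso = dom: operad P + cod: operad R
  for P :: "'a operad" and R :: "'b operad" +
  fixes \<phi> :: "nat \<Rightarrow> 'a \<Rightarrow> 'b"
  assumes iso_bij: "n \<ge> 1 \<Longrightarrow> bij_betw (\<phi> n) (elts P n) (elts R n)"
    and iso_act:
      "\<lbrakk>n \<ge> 1; \<sigma> permutes {1..n}; x \<in> elts P n\<rbrakk> \<Longrightarrow> \<phi> n (oact P n \<sigma> x) = oact R n \<sigma> (\<phi> n x)"
    and iso_unit: "\<phi> 1 (ounit P) = ounit R"
    and iso_comp:
      "\<lbrakk>n \<ge> 1; m \<ge> 1; k \<in> {1..n}; x \<in> elts P n; y \<in> elts P m\<rbrakk>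
       \<Longrightarrow> \<phi> (n + m - 1) (ocomp P n m k x y) = ocomp R n m k (\<phi> n x) (\<phi> m y)"


section \<open>Simplicial complexes\<close>

text \<open>Both \<open>{}\<close> and \<open>{{}}\<close> are complexes, and not every vertex needs to be a face.\<close>

definition scpx :: "nat \<Rightarrow> nat set set set" where
  "scpx n = {K. K \<subseteq> Pow {1..n} \<and> (\<forall>I\<in>K. \<forall>J. J \<subseteq> I \<longrightarrow> J \<in> K)}"

definition scpx_ne :: "nat \<Rightarrow> nat set set set" where
  "scpx_ne n = {K \<in> scpx n. K \<noteq> {}}"

definition relscpx :: "nat \<Rightarrow> (nat set set \<times> nat set set) set" where
  "relscpx n = {(K, L). K \<in> scpx n \<and> L \<in> scpx n \<and> L \<subseteq> K}"

definition full_simplex :: "nat \<Rightarrow> nat set set" where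
  "full_simplex n = Pow {1..n}"

definition relabel :: "(nat \<Rightarrow> nat) \<Rightarrow> nat set set \<Rightarrow> nat set set" where
  "relabel \<sigma> K = (\<lambda>I. \<sigma> ` I) ` K"

definition below :: "nat set \<Rightarrow> nat \<Rightarrow> nat set" where
  "below I k = {i \<in> I. i < k}"

definition above :: "nat set \<Rightarrow> nat \<Rightarrow> nat set" where
  "above I k = {i \<in> I. i > k}"

definition shift :: "nat set \<Rightarrow> nat \<Rightarrow> nat set" where
  "shift I l = (\<lambda>i. i + l) ` I"


section \<open>The substitution and composition operads\<close>

text \<open>Below, \<open>m\<close> is the arity of the second argument and \<open>k, m \<ge> 1\<close>, so no subtraction truncates.\<close>

definition face_subst :: "nat \<Rightarrow> nat \<Rightarrow> nat set \<Rightarrow> nat set \<Rightarrow> nat set" where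
  "face_subst m k I J =
     (if k \<in> I then below I k \<union> shift J (k - 1) \<union> shift (above I k) (m - 1)
      else below I k \<union> shift (above I k) (m - 1))"

definition face_comp :: "nat \<Rightarrow> nat \<Rightarrow> nat set \<Rightarrow> nat set \<Rightarrow> nat set" where
  "face_comp m k I J =
     (if k \<in> I then below I k \<union> shift {1..m} (k - 1) \<union> shift (above I k) (m - 1)
      else below I k \<union> shift J (k - 1) \<union> shift (above I k) (m - 1))"

definition scpx_subst :: "nat \<Rightarrow> nat \<Rightarrow> nat set set \<Rightarrow> nat set set \<Rightarrow> nat set set" where
  "scpx_subst m k K L = {face_subst m k I J | I J. I \<in> K \<and> J \<in> L}"

definition scpx_comp :: "nat \<Rightarrow> nat \<Rightarrow> nat set set \<Rightarrow> nat set set \<Rightarrow> nat set set" where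
  "scpx_comp m k K L = {F. \<exists>I\<in>K. \<exists>J\<in>L. F \<subseteq> face_comp m k I J}"

definition substitution_operad :: "nat set set operad" where
  "substitution_operad =
     \<lparr>elts = scpx_ne, oact = (\<lambda>n. relabel), ocomp = (\<lambda>n. scpx_subst), ounit = {{}, {1}}\<rparr>"

definition composition_operad :: "nat set set operad" where
  "composition_operad =
     \<lparr>elts = scpx_ne, oact = (\<lambda>n. relabel), ocomp = (\<lambda>n. scpx_comp), ounit = {{}}\<rparr>"


section \<open>The operad of relative simplicial complexes\<close>

definition join :: "nat \<Rightarrow> nat set set \<Rightarrow> nat set set \<Rightarrow> nat set set" where
  "join n\<^sub>1 K\<^sub>1 K\<^sub>2 = {I\<^sub>1 \<union> shift I\<^sub>2 n\<^sub>1 | I\<^sub>1 I\<^sub>2. I\<^sub>1 \<in> K\<^sub>1 \<and> I\<^sub>2 \<in> K\<^sub>2}"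

text \<open>
  Iterated join \<open>K\<^sub>1 \<^bold>* \<dots> \<^bold>* K\<^sub>r\<close> of a list of pairs \<open>(n\<^sub>i, K\<^sub>i)\<close> with \<open>K\<^sub>i\<close> a complex on \<open>[n\<^sub>i]\<close>. The empty
  join \<open>{{}}\<close> is the neutral element.
\<close>

fun joins :: "(nat \<times> nat set set) list \<Rightarrow> nat set set" where
  "joins [] = {{}}"
| "joins ((n, K) # Ks) = join n K (joins Ks)"

definition join_factor ::
    "nat \<Rightarrow> nat \<Rightarrow> nat set set \<Rightarrow> nat set set \<Rightarrow> nat set \<Rightarrow> nat \<Rightarrow> nat \<times> nat set set" where
  "join_factor m k M N I j =
     (if j = k then (m, if k \<in> I then M else N)
      else (1, if j \<in> I then {{}, {1}} else {{}}))"

definition rel_subst ::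
    "nat \<Rightarrow> nat \<Rightarrow> nat \<Rightarrow> nat set set \<Rightarrow> nat set set \<times> nat set set \<Rightarrow> nat set set" where
  "rel_subst n m k K MN =
     (\<Union>I\<in>K. joins (map (join_factor m k (fst MN) (snd MN) I) [1..<Suc n]))"

definition relscpx_operad :: "(nat set set \<times> nat set set) operad" where
  "relscpx_operad =
     \<lparr>elts = relscpx,
      oact = (\<lambda>n \<sigma> (K, L). (relabel \<sigma> K, relabel \<sigma> L)),
      ocomp = (\<lambda>n m k (K, L) MN. (rel_subst n m k K MN, rel_subst n m k L MN)),
      ounit = ({{}, {1}}, {{}})\<rparr>"

definition rel_empty_face :: "nat \<Rightarrow> (nat set set \<times> nat set set) set" where
  "rel_empty_face n = {(K, L) \<in> relscpx n. L = {{}}}"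

definition rel_in_simplex :: "nat \<Rightarrow> (nat set set \<times> nat set set) set" where
  "rel_in_simplex n = {(K, L) \<in> relscpx n. K = full_simplex n \<and> L \<noteq> {}}"

end

theory Submission
  imports Defs
begin

text \<open>
  The associativity, unit and equivariance laws of relative complexes become trivial once a pair
  \<open>(K, L)\<close> on \<open>[n]\<close> is read as an \<open>n\<close>-ary operation on a three-element set. A subset \<open>F\<close> of \<open>[n]\<close> lies
  in one of three zones: in \<open>L\<close>, in \<open>K\<close> but not in \<open>L\<close>, or outside \<open>K\<close>. Since \<open>L \<subseteq> K\<close>, the zone of every
  \<open>F\<close> determines the pair. Call the zones \<open>Inner\<close>, \<open>Middle\<close>, \<open>Outside\<close>, encode \<open>F\<close> by assigning
  \<open>Middle\<close> to its elements and \<open>Inner\<close> to all other vertices, and extend by letting the result be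
  \<open>Outside\<close> as soon as one argument is: this is the operation \<open>zone_fun n (K, L)\<close>.

  The point is that \<open>\<circ>\<^sub>k\<^sup>*\<close> becomes substitution of operations (\<open>zone_fun_rel_subst\<close>). Split a face \<open>F\<close> of
  the composite into its block part \<open>B \<subseteq> [m]\<close> and its outer part \<open>O \<subseteq> [n] - {k}\<close>. Because \<open>K\<close> is closed
  under subsets, the union over the faces of \<open>K\<close> that defines the composite collapses to one condition
  (\<open>mem_rel_subst_iff\<close>): \<open>B \<in> M\<close>, and \<open>O \<in> K\<close> or \<open>O \<union> {k} \<in> K\<close> according to whether \<open>B \<in> N\<close> or not. So
  the zone of \<open>B\<close> in \<open>(M, N)\<close> is exactly what has to be fed into input \<open>k\<close>. Hence relative complexes embed
  into an endomorphism operad, and the operad laws are inherited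
  (\<open>operad_of_faithful_representation\<close>).

  The same membership criterion gives both halves of the proposition. If \<open>N = {{}}\<close>, then \<open>k\<close> is added to
  the outer part precisely when \<open>B\<close> is nonempty, which describes the faces \<open>I \<circ>\<^sub>k J\<close>. If \<open>M\<close> is the full
  simplex, then \<open>B\<close> is arbitrary when \<open>O \<union> {k} \<in> K\<close> and has to lie in \<open>N\<close> otherwise, which describes the
  subsets of the faces \<open>I \<circ>\<^sub>k\<^sup>c J\<close>. The operad laws of the substitution and composition operads need
  no separate argument, as they are transported along the bijections (\<open>operad_iso_of_bijection\<close>).
\<close>

section \<open>Positions after inserting a block\<close>

text \<open>
  Index computations use this dichotomy instead of the piecewise formulas. It covers all natural
  numbers, so that it also handles the points outside \<open>[n + m - 1]\<close>, which a permutation has to fix;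
  \<open>0\<close> counts as an outer position.
\<close>

lemma position_cases:
  fixes k m a :: nat
  assumes "k \<ge> 1" "m \<ge> 1"
  obtains (outer) i where "i \<noteq> k" "a = outer_pos m k i"
    | (block) j where "j \<in> {1..m}" "a = j + k - 1"
proof -
  consider "a < k" | "k \<le> a" "a < k + m" | "k + m \<le> a" by linarith
  then show thesis
  proof cases
    case 1
    then show thesis using outer[of a] by (simp add: outer_pos_def)
  next
    case 2
    then show thesis using assms by (intro block[of "a + 1 - k"]) auto
  next
    case 3
    then show thesis using outer[of "a + 1 - m"] assms by (simp add: outer_pos_def)
  qed
qed

lemma outer_pos_in_range_iff:
  assumes "k \<in> {1..n}" "m \<ge> 1" "i \<noteq> k"
  shows "outer_pos m k i \<in> {1..n + m - 1} \<longleftrightarrow> i \<in> {1..n}"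
  using assms by (auto simp: outer_pos_def)

lemma block_pos_in_range:
  fixes k n m j :: nat
  assumes "k \<in> {1..n}" "j \<in> {1..m}"
  shows "j + k - 1 \<in> {1..n + m - 1}"
  using assms by auto

lemma outer_pos_eq_iff:
  assumes "m \<ge> 1" "i \<noteq> k" "i' \<noteq> k"
  shows "outer_pos m k i = outer_pos m k i' \<longleftrightarrow> i = i'"
  using assms by (auto simp: outer_pos_def)

lemma outer_pos_neq_block_pos:
  assumes "k \<ge> 1" "i \<noteq> k" "j \<in> {1..m}"
  shows "outer_pos m k i \<noteq> j + k - 1"
  using assms by (auto simp: outer_pos_def)

lemma perm_comp_outer_pos:
  assumes "m \<ge> 1" "i \<noteq> k"
  shows "perm_comp m k \<sigma> \<tau> (outer_pos m k i) = outer_pos m (\<sigma> k) (\<sigma> i)"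
  using assms by (auto simp: perm_comp_def outer_pos_def)

lemma perm_comp_block_pos:
  assumes "k \<ge> 1" "j \<in> {1..m}"
  shows "perm_comp m k \<sigma> \<tau> (j + k - 1) = \<tau> j + \<sigma> k - 1"
  using assms by (auto simp: perm_comp_def)

lemma perm_comp_left_inverse:
  assumes "m \<ge> 1" "k \<in> {1..n}" "\<sigma> permutes {1..n}" "\<tau> permutes {1..m}"
  shows "perm_comp m (\<sigma> k) (inv \<sigma>) (inv \<tau>) (perm_comp m k \<sigma> \<tau> a) = a"
proof -
  have k: "\<sigma> k \<in> {1..n}" using assms permutes_in_image by metis
  from assms have "k \<ge> 1" by simp
  then show ?thesis using \<open>m \<ge> 1\<close>
  proof (cases rule: position_cases[of k m a])
    case (outer i)
    then have "\<sigma> i \<noteq> \<sigma> k" using permutes_inj[OF assms(3)] by (simp add: inj_eq)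
    then show ?thesis using outer assms by (simp add: perm_comp_outer_pos permutes_inverses)
  next
    case (block j)
    then have "\<tau> j \<in> {1..m}" using assms permutes_in_image by metis
    then have "perm_comp m (\<sigma> k) (inv \<sigma>) (inv \<tau>) (\<tau> j + \<sigma> k - 1) = inv \<tau> (\<tau> j) + inv \<sigma> (\<sigma> k) - 1"
      using k by (intro perm_comp_block_pos) auto
    then show ?thesis using block assms by (simp add: perm_comp_block_pos[simplified] permutes_inverses)
  qed
qed

text \<open>
  The equivariance law applies the action to this function, which the action axioms control only for
  permutations. It maps \<open>[n + m - 1]\<close> to itself and is injective there, having a left inverse of the
  same form.
\<close>

lemma perm_comp_permutes:
  assumes "m \<ge> 1" "k \<in> {1..n}" "\<sigma> permutes {1..n}" "\<tau> permutes {1..m}"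
  shows "perm_comp m k \<sigma> \<tau> permutes {1..n + m - 1}"
proof (rule inj_imp_permutes)
  have k: "\<sigma> k \<in> {1..n}" "k \<ge> 1" using assms permutes_in_image[OF assms(3)] by auto
  show "inj_on (perm_comp m k \<sigma> \<tau>) {1..n + m - 1}"
    using perm_comp_left_inverse[OF assms] by (rule inj_on_inverseI)
  show "finite {1..n + m - 1}" by simp
  show "perm_comp m k \<sigma> \<tau> a \<in> {1..n + m - 1}" if "a \<in> {1..n + m - 1}" for a
    using k(2) \<open>m \<ge> 1\<close>
  proof (cases rule: position_cases[of k m a])
    case (outer i)
    then have "\<sigma> i \<noteq> \<sigma> k" using permutes_inj[OF assms(3)] by (simp add: inj_eq)
    moreover have "\<sigma> i \<in> {1..n}"
      using outer that assms outer_pos_in_range_iff permutes_in_image by metis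
    ultimately show ?thesis
      using outer assms k outer_pos_in_range_iff by (simp add: perm_comp_outer_pos)
  next
    case (block j)
    then have "\<tau> j \<in> {1..m}" using assms permutes_in_image by metis
    then have "\<tau> j + \<sigma> k - 1 \<in> {1..n + m - 1}" using k by (intro block_pos_in_range)
    then show ?thesis using block k by (simp add: perm_comp_block_pos[simplified])
  qed
  show "perm_comp m k \<sigma> \<tau> a = a" if "a \<notin> {1..n + m - 1}" for a
    using k(2) \<open>m \<ge> 1\<close>
  proof (cases rule: position_cases[of k m a])
    case (outer i)
    then have i: "i \<notin> {1..n}" using that assms outer_pos_in_range_iff by metis
    then have "\<sigma> i = i" using assms permutes_not_in by metis
    then show ?thesis using outer i assms k
      by (auto simp: perm_comp_outer_pos) (auto simp: outer_pos_def)
  next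
    case (block j)
    then show ?thesis using that assms block_pos_in_range by metis
  qed
qed

section \<open>Operads from faithful representations and isomorphisms\<close>

text \<open>
  The hypotheses say that \<open>ev\<close> embeds \<open>P\<close> into the endomorphism operad of \<open>'v\<close>: composition goes to
  plugging one operation into an input of another. There all operad laws hold by comparing which
  coordinate of \<open>v\<close> each argument reads, and injectivity of \<open>ev\<close> pulls them back to \<open>P\<close>. An operation of
  arity \<open>n\<close> takes a whole sequence \<open>v\<close>, so that all arities share one type; the locality hypothesis
  restricts attention to the coordinates \<open>1, \<dots>, n\<close>.
\<close>

lemma operad_of_faithful_representation:
  fixes P :: "'a operad" and ev :: "nat \<Rightarrow> 'a \<Rightarrow> (nat \<Rightarrow> 'v) \<Rightarrow> 'v"
  assumes act_cl: "\<And>n \<sigma> x. \<lbrakk>n \<ge> 1; \<sigma> permutes {1..n}; x \<in> elts P n\<rbrakk> \<Longrightarrow> oact P n \<sigma> x \<in> elts P n"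
    and unit_cl: "ounit P \<in> elts P 1"
    and comp_cl: "\<And>n m k x y. \<lbrakk>n \<ge> 1; m \<ge> 1; k \<in> {1..n}; x \<in> elts P n; y \<in> elts P m\<rbrakk>
       \<Longrightarrow> ocomp P n m k x y \<in> elts P (n + m - 1)"
    and inj: "\<And>n. n \<ge> 1 \<Longrightarrow> inj_on (ev n) (elts P n)"
    and local: "\<And>n x v w. \<lbrakk>n \<ge> 1; x \<in> elts P n; \<And>i. i \<in> {1..n} \<Longrightarrow> v i = w i\<rbrakk> \<Longrightarrow> ev n x v = ev n x w"
    and act_ev: "\<And>n \<sigma> x v. \<lbrakk>n \<ge> 1; \<sigma> permutes {1..n}; x \<in> elts P n\<rbrakk>
       \<Longrightarrow> ev n (oact P n \<sigma> x) v = ev n x (v \<circ> \<sigma>)"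
    and unit_ev: "\<And>v. ev 1 (ounit P) v = v 1"
    and comp_ev: "\<And>n m k x y v. \<lbrakk>n \<ge> 1; m \<ge> 1; k \<in> {1..n}; x \<in> elts P n; y \<in> elts P m\<rbrakk>
       \<Longrightarrow> ev (n + m - 1) (ocomp P n m k x y) v
         = ev n x (\<lambda>i. if i = k then ev m y (\<lambda>j. v (j + k - 1)) else v (outer_pos m k i))"
  shows "operad P"
proof -
  have eqI: "x = y"
    if "n \<ge> 1" "x \<in> elts P n" "y \<in> elts P n" "\<And>v. ev n x v = ev n y v" for n x y
    using inj_onD[OF inj, of n x y] that by blast
  show ?thesis
  proof
    fix n :: nat and x assume "n \<ge> 1" "x \<in> elts P n"
    then show "oact P n id x = x"
      by (intro eqI[of n]) (auto simp: act_cl act_ev permutes_id)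
  next
    fix n :: nat and \<sigma> \<tau> x
    assume "n \<ge> 1" "\<sigma> permutes {1..n}" "\<tau> permutes {1..n}" "x \<in> elts P n"
    then show "oact P n (\<sigma> \<circ> \<tau>) x = oact P n \<sigma> (oact P n \<tau> x)"
      by (intro eqI[of n]) (auto simp: act_cl act_ev permutes_compose comp_assoc)
  next
    fix n :: nat and x assume a: "n \<ge> 1" "x \<in> elts P n"
    show "ocomp P 1 n 1 (ounit P) x = x"
    proof (rule eqI)
      show "ocomp P 1 n 1 (ounit P) x \<in> elts P n"
        using comp_cl[of 1 n 1 "ounit P" x] a unit_cl by simp
      fix v :: "nat \<Rightarrow> 'v" show "ev n (ocomp P 1 n 1 (ounit P) x) v = ev n x v"
        using comp_ev[of 1 n 1 "ounit P" x v] a unit_cl unit_ev by simp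
    qed (use a in auto)
  next
    fix n k :: nat and x assume a: "n \<ge> 1" "k \<in> {1..n}" "x \<in> elts P n"
    show "ocomp P n 1 k x (ounit P) = x"
    proof (rule eqI)
      show "ocomp P n 1 k x (ounit P) \<in> elts P n"
        using comp_cl[of n 1 k x "ounit P"] a unit_cl by simp
      fix v :: "nat \<Rightarrow> 'v"
      have "(\<lambda>i. if i = k then v (1 + k - 1) else v (outer_pos 1 k i)) = v"
        by (auto simp: outer_pos_def)
      then show "ev n (ocomp P n 1 k x (ounit P)) v = ev n x v"
        using comp_ev[of n 1 k x "ounit P" v, unfolded unit_ev] a unit_cl by (metis add_diff_cancel_right' order_refl)
    qed (use a in auto)
  next
    fix n m l i j :: nat and x y z
    assume a: "n \<ge> 1" "m \<ge> 1" "l \<ge> 1" "i \<in> {1..n}" "j \<in> {1..m}"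
      "x \<in> elts P n" "y \<in> elts P m" "z \<in> elts P l"
    let ?xy = "ocomp P n m i x y" and ?yz = "ocomp P m l j y z"
    have xy: "?xy \<in> elts P (n + m - 1)" and yz: "?yz \<in> elts P (m + l - 1)"
      using a comp_cl by auto
    have r: "i + j - 1 \<in> {1..n + m - 1}" "n + m - 1 \<ge> 1" "m + l - 1 \<ge> 1"
      "n + m - 1 + l - 1 = n + (m + l - 1) - 1" using a by auto
    show "ocomp P (n + m - 1) l (i + j - 1) ?xy z = ocomp P n (m + l - 1) i x ?yz"
    proof (rule eqI)
      show "n + m - 1 + l - 1 \<ge> 1" using a by auto
      show "ocomp P (n + m - 1) l (i + j - 1) ?xy z \<in> elts P (n + m - 1 + l - 1)"
        using comp_cl xy r a by blast
      show "ocomp P n (m + l - 1) i x ?yz \<in> elts P (n + m - 1 + l - 1)"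
        unfolding r(4) using comp_cl yz r a by blast
      fix v :: "nat \<Rightarrow> 'v"
      \<comment> \<open>The arguments that the inner composite passes on, once \<open>z\<close> has been evaluated in its block.\<close>
      define w where "w p = (if p = i + j - 1 then ev l z (\<lambda>q. v (q + (i + j - 1) - 1))
          else v (outer_pos l (i + j - 1) p))" for p
      have block: "w (b + i - 1)
          = (if b = j then ev l z (\<lambda>q. v (q + j - 1 + i - 1)) else v (outer_pos l j b + i - 1))" for b
      proof -
        have "(\<lambda>q. v (q + (i + j - 1) - 1)) = (\<lambda>q. v (q + j - 1 + i - 1))"
          using a by (intro ext arg_cong[of _ _ v]) auto
        moreover have "b + i - 1 = i + j - 1 \<longleftrightarrow> b = j" using a by auto
        moreover have "b \<noteq> j \<Longrightarrow> outer_pos l (i + j - 1) (b + i - 1) = outer_pos l j b + i - 1"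
          using a by (auto simp: outer_pos_def)
        ultimately show ?thesis by (simp add: w_def)
      qed
      have outer: "w (outer_pos m i c) = v (outer_pos (m + l - 1) i c)" if "c \<noteq> i" for c
      proof -
        have "outer_pos m i c \<noteq> i + j - 1"
          "outer_pos l (i + j - 1) (outer_pos m i c) = outer_pos (m + l - 1) i c"
          using a that by (auto simp: outer_pos_def)
        then show ?thesis by (simp add: w_def)
      qed
      have "ev (n + m - 1 + l - 1) (ocomp P (n + m - 1) l (i + j - 1) ?xy z) v
          = ev (n + m - 1) ?xy w"
        unfolding w_def using comp_ev xy r a by blast
      also have "\<dots> = ev n x (\<lambda>c. if c = i then ev m y (\<lambda>b. w (b + i - 1)) else w (outer_pos m i c))"
        using comp_ev a by blast
      also have "\<dots> = ev n x (\<lambda>c. if c = i then ev (m + l - 1) ?yz (\<lambda>b. v (b + i - 1))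
          else v (outer_pos (m + l - 1) i c))"
      proof (intro arg_cong[of _ _ "ev n x"] ext)
        fix c
        have "ev (m + l - 1) ?yz (\<lambda>b. v (b + i - 1)) = ev m y (\<lambda>b. w (b + i - 1))"
          unfolding block using comp_ev[of m l j y z "\<lambda>b. v (b + i - 1)"] a by simp
        then show "(if c = i then ev m y (\<lambda>b. w (b + i - 1)) else w (outer_pos m i c))
          = (if c = i then ev (m + l - 1) ?yz (\<lambda>b. v (b + i - 1)) else v (outer_pos (m + l - 1) i c))"
          using outer by simp
      qed
      also have "\<dots> = ev (n + m - 1 + l - 1) (ocomp P n (m + l - 1) i x ?yz) v"
        unfolding r(4) using comp_ev[of n "m + l - 1" i x ?yz v] yz r a by metis
      finally show "ev (n + m - 1 + l - 1) (ocomp P (n + m - 1) l (i + j - 1) ?xy z) v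
        = ev (n + m - 1 + l - 1) (ocomp P n (m + l - 1) i x ?yz) v" .
    qed
  next
    fix n m l i j :: nat and x y z
    assume a: "n \<ge> 1" "m \<ge> 1" "l \<ge> 1" "i \<in> {1..n}" "j \<in> {1..n}" "i < j"
      "x \<in> elts P n" "y \<in> elts P m" "z \<in> elts P l"
    let ?xy = "ocomp P n m i x y" and ?xz = "ocomp P n l j x z"
    have xy: "?xy \<in> elts P (n + m - 1)" and xz: "?xz \<in> elts P (n + l - 1)"
      using a comp_cl by auto
    have r: "j + m - 1 \<in> {1..n + m - 1}" "n + m - 1 \<ge> 1" "n + l - 1 \<ge> 1" "i \<in> {1..n + l - 1}"
      "n + m - 1 + l - 1 = n + l - 1 + m - 1" using a by auto
    show "ocomp P (n + m - 1) l (j + m - 1) ?xy z = ocomp P (n + l - 1) m i ?xz y"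
    proof (rule eqI)
      show "n + m - 1 + l - 1 \<ge> 1" using a by auto
      show "ocomp P (n + m - 1) l (j + m - 1) ?xy z \<in> elts P (n + m - 1 + l - 1)"
        using comp_cl xy r a by blast
      show "ocomp P (n + l - 1) m i ?xz y \<in> elts P (n + m - 1 + l - 1)"
        unfolding r(5) using comp_cl xz r a by blast
      fix v :: "nat \<Rightarrow> 'v"
      \<comment> \<open>\<open>w\<close> and \<open>u\<close> are the arguments left after evaluating only \<open>z\<close>, respectively only \<open>y\<close>.
        Evaluating the remaining block then gives the same input to \<open>x\<close> in both orders (\<open>same\<close>).\<close>
      define w where "w p = (if p = j + m - 1 then ev l z (\<lambda>q. v (q + (j + m - 1) - 1))
          else v (outer_pos l (j + m - 1) p))" for p
      define u where "u p = (if p = i then ev m y (\<lambda>q. v (q + i - 1))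
          else v (outer_pos m i p))" for p
      have y: "ev m y (\<lambda>b. w (b + i - 1)) = ev m y (\<lambda>q. v (q + i - 1))"
        using a by (intro local) (auto simp: w_def outer_pos_def)
      have z: "ev l z (\<lambda>b. u (b + j - 1)) = ev l z (\<lambda>q. v (q + (j + m - 1) - 1))"
        using a by (intro local) (auto simp: u_def outer_pos_def intro!: arg_cong[of _ _ v])
      have same: "(if c = i then ev m y (\<lambda>b. w (b + i - 1)) else w (outer_pos m i c))
        = (if c = j then ev l z (\<lambda>b. u (b + j - 1)) else u (outer_pos l j c))" for c
        unfolding y z using a by (auto simp: w_def u_def outer_pos_def intro!: arg_cong[of _ _ v])
      have "ev (n + m - 1 + l - 1) (ocomp P (n + m - 1) l (j + m - 1) ?xy z) v
          = ev (n + m - 1) ?xy w"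
        unfolding w_def using comp_ev xy r a by blast
      also have "\<dots> = ev n x (\<lambda>c. if c = i then ev m y (\<lambda>b. w (b + i - 1)) else w (outer_pos m i c))"
        using comp_ev a by blast
      also have "\<dots> = ev n x (\<lambda>c. if c = j then ev l z (\<lambda>b. u (b + j - 1)) else u (outer_pos l j c))"
        unfolding same ..
      also have "\<dots> = ev (n + l - 1) ?xz u"
        using comp_ev[of n l j x z u] a by metis
      also have "\<dots> = ev (n + m - 1 + l - 1) (ocomp P (n + l - 1) m i ?xz y) v"
        unfolding u_def r(5) using comp_ev[of "n + l - 1" m i ?xz y v] xz r a by metis
      finally show "ev (n + m - 1 + l - 1) (ocomp P (n + m - 1) l (j + m - 1) ?xy z) v
        = ev (n + m - 1 + l - 1) (ocomp P (n + l - 1) m i ?xz y) v" .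
    qed
  next
    fix n m k :: nat and \<sigma> \<tau> x y
    assume a: "n \<ge> 1" "m \<ge> 1" "k \<in> {1..n}" "\<sigma> permutes {1..n}" "\<tau> permutes {1..m}"
      "x \<in> elts P n" "y \<in> elts P m"
    show "ocomp P n m (\<sigma> k) (oact P n \<sigma> x) (oact P m \<tau> y)
         = oact P (n + m - 1) (perm_comp m k \<sigma> \<tau>) (ocomp P n m k x y)"
    proof (rule eqI)
      let ?\<pi> = "perm_comp m k \<sigma> \<tau>"
      have \<sigma>k: "\<sigma> k \<in> {1..n}" using a permutes_in_image by metis
      have \<pi>: "?\<pi> permutes {1..n + m - 1}" using a by (intro perm_comp_permutes)
      show nm: "n + m - 1 \<ge> 1" using a by auto
      have xy: "ocomp P n m k x y \<in> elts P (n + m - 1)" using a comp_cl by blast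
      have acts: "oact P n \<sigma> x \<in> elts P n" "oact P m \<tau> y \<in> elts P m" using a act_cl by auto
      show "ocomp P n m (\<sigma> k) (oact P n \<sigma> x) (oact P m \<tau> y) \<in> elts P (n + m - 1)"
        using a acts \<sigma>k comp_cl by blast
      show "oact P (n + m - 1) ?\<pi> (ocomp P n m k x y) \<in> elts P (n + m - 1)"
        using act_cl nm \<pi> xy by blast
      fix v :: "nat \<Rightarrow> 'v"
      have inj_\<sigma>: "\<sigma> i = \<sigma> k \<longleftrightarrow> i = k" for i
        using permutes_inj[OF a(4)] by (simp add: inj_eq)
      have block: "ev m y (\<lambda>j. v (\<tau> j + \<sigma> k - 1)) = ev m y (\<lambda>j. v (?\<pi> (j + k - 1)))"
        using a by (intro local) (auto simp: perm_comp_block_pos[simplified])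
      have outer: "v (outer_pos m (\<sigma> k) (\<sigma> i)) = v (?\<pi> (outer_pos m k i))" if "i \<noteq> k" for i
        using a that by (simp add: perm_comp_outer_pos)
      have "ev (n + m - 1) (ocomp P n m (\<sigma> k) (oact P n \<sigma> x) (oact P m \<tau> y)) v
        = ev n (oact P n \<sigma> x) (\<lambda>i. if i = \<sigma> k then ev m (oact P m \<tau> y) (\<lambda>j. v (j + \<sigma> k - 1))
            else v (outer_pos m (\<sigma> k) i))"
        using a acts \<sigma>k comp_ev by blast
      also have "\<dots> = ev n x (\<lambda>i. if i = k then ev m y (\<lambda>j. v (\<tau> j + \<sigma> k - 1))
            else v (outer_pos m (\<sigma> k) (\<sigma> i)))"
      proof -
        have "ev m (oact P m \<tau> y) (\<lambda>j. v (j + \<sigma> k - 1)) = ev m y (\<lambda>j. v (\<tau> j + \<sigma> k - 1))"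
          unfolding act_ev[OF a(2,5,7)] by (simp only: comp_def)
        then show ?thesis unfolding act_ev[OF a(1,4,6)] by (simp only: comp_def inj_\<sigma>)
      qed
      also have "\<dots> = ev n x (\<lambda>i. if i = k then ev m y (\<lambda>j. (v \<circ> ?\<pi>) (j + k - 1))
            else (v \<circ> ?\<pi>) (outer_pos m k i))"
      proof (intro arg_cong[of _ _ "ev n x"] ext)
        fix i
        show "(if i = k then ev m y (\<lambda>j. v (\<tau> j + \<sigma> k - 1)) else v (outer_pos m (\<sigma> k) (\<sigma> i)))
          = (if i = k then ev m y (\<lambda>j. (v \<circ> ?\<pi>) (j + k - 1)) else (v \<circ> ?\<pi>) (outer_pos m k i))"
          by (cases "i = k") (simp_all only: comp_apply block outer simp_thms if_True if_False)
      qed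
      also have "\<dots> = ev (n + m - 1) (ocomp P n m k x y) (v \<circ> ?\<pi>)"
        using a comp_ev[of n m k x y "v \<circ> ?\<pi>"] by metis
      also have "\<dots> = ev (n + m - 1) (oact P (n + m - 1) ?\<pi> (ocomp P n m k x y)) v"
        using act_ev nm \<pi> xy by metis
      finally show "ev (n + m - 1) (ocomp P n m (\<sigma> k) (oact P n \<sigma> x) (oact P m \<tau> y)) v
        = ev (n + m - 1) (oact P (n + m - 1) ?\<pi> (ocomp P n m k x y)) v" .
    qed
  qed (use act_cl unit_cl comp_cl in auto)
qed

lemma operad_restrict_suboperad:
  assumes "suboperad P Q"
  shows "operad (restrict_operad P Q)"
proof -
  interpret suboperad P Q by fact
  have Q: "x \<in> elts P n" if "n \<ge> 1" "x \<in> Q n" for n x using sub_elts that by blast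
  show ?thesis
    by unfold_locales
      (auto simp: restrict_operad_def sub_act sub_unit[simplified] sub_comp[simplified] act_id act_comp unit_left[simplified]
        unit_right[simplified] Q assoc_sequential[simplified] assoc_parallel[simplified] equivariance[simplified])
qed

text \<open>
  The target is not assumed to be an operad: every one of its elements is the image of an element of
  \<open>P\<close>, so each law follows from the corresponding law of \<open>P\<close>.
\<close>

lemma operad_iso_of_bijection:
  fixes P :: "'a operad" and R :: "'b operad" and \<phi> :: "nat \<Rightarrow> 'a \<Rightarrow> 'b"
  assumes "operad P"
    and bij: "\<And>n. n \<ge> 1 \<Longrightarrow> bij_betw (\<phi> n) (elts P n) (elts R n)"
    and act: "\<And>n \<sigma> x. \<lbrakk>n \<ge> 1; \<sigma> permutes {1..n}; x \<in> elts P n\<rbrakk>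
       \<Longrightarrow> oact R n \<sigma> (\<phi> n x) = \<phi> n (oact P n \<sigma> x)"
    and unit: "ounit R = \<phi> 1 (ounit P)"
    and comp: "\<And>n m k x y. \<lbrakk>n \<ge> 1; m \<ge> 1; k \<in> {1..n}; x \<in> elts P n; y \<in> elts P m\<rbrakk>
       \<Longrightarrow> ocomp R n m k (\<phi> n x) (\<phi> m y) = \<phi> (n + m - 1) (ocomp P n m k x y)"
  shows "operad_iso P R \<phi>"
proof -
  interpret dom: operad P by fact
  have im: "elts R n = \<phi> n ` elts P n" if "n \<ge> 1" for n
    using bij[OF that] by (simp add: bij_betw_def)
  have "operad R"
  proof
    fix n m l i j :: nat and x y z
    assume a: "n \<ge> 1" "m \<ge> 1" "l \<ge> 1" "i \<in> {1..n}" "j \<in> {1..m}"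
      "x \<in> elts R n" "y \<in> elts R m" "z \<in> elts R l"
    then obtain x' y' z' where p: "x' \<in> elts P n" "y' \<in> elts P m" "z' \<in> elts P l"
      and e: "x = \<phi> n x'" "y = \<phi> m y'" "z = \<phi> l z'" using im by auto
    have r: "i + j - 1 \<in> {1..n + m - 1}" "n + m - 1 \<ge> 1" "m + l - 1 \<ge> 1"
      "n + m - 1 + l - 1 = n + (m + l - 1) - 1" using a by auto
    have "ocomp R (n + m - 1) l (i + j - 1) (ocomp R n m i x y) z
        = \<phi> (n + m - 1 + l - 1) (ocomp P (n + m - 1) l (i + j - 1) (ocomp P n m i x' y') z')"
      unfolding e using a p r comp dom.comp_closed by metis
    also have "\<dots> = \<phi> (n + m - 1 + l - 1) (ocomp P n (m + l - 1) i x' (ocomp P m l j y' z'))"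
      using dom.assoc_sequential a p by metis
    also have "\<dots> = ocomp R n (m + l - 1) i x (ocomp R m l j y z)"
      unfolding e using a p r comp dom.comp_closed by metis
    finally show "ocomp R (n + m - 1) l (i + j - 1) (ocomp R n m i x y) z
        = ocomp R n (m + l - 1) i x (ocomp R m l j y z)" .
  next
    fix n m l i j :: nat and x y z
    assume a: "n \<ge> 1" "m \<ge> 1" "l \<ge> 1" "i \<in> {1..n}" "j \<in> {1..n}" "i < j"
      "x \<in> elts R n" "y \<in> elts R m" "z \<in> elts R l"
    then obtain x' y' z' where p: "x' \<in> elts P n" "y' \<in> elts P m" "z' \<in> elts P l"
      and e: "x = \<phi> n x'" "y = \<phi> m y'" "z = \<phi> l z'" using im by auto
    have r: "j + m - 1 \<in> {1..n + m - 1}" "n + m - 1 \<ge> 1" "n + l - 1 \<ge> 1" "i \<in> {1..n + l - 1}"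
      "n + m - 1 + l - 1 = n + l - 1 + m - 1" using a by auto
    have "ocomp R (n + m - 1) l (j + m - 1) (ocomp R n m i x y) z
        = \<phi> (n + m - 1 + l - 1) (ocomp P (n + m - 1) l (j + m - 1) (ocomp P n m i x' y') z')"
      unfolding e using a p r comp dom.comp_closed by metis
    also have "\<dots> = \<phi> (n + m - 1 + l - 1) (ocomp P (n + l - 1) m i (ocomp P n l j x' z') y')"
      using dom.assoc_parallel a p by metis
    also have "\<dots> = ocomp R (n + l - 1) m i (ocomp R n l j x z) y"
      unfolding e using a p r comp dom.comp_closed by metis
    finally show "ocomp R (n + m - 1) l (j + m - 1) (ocomp R n m i x y) z
        = ocomp R (n + l - 1) m i (ocomp R n l j x z) y" .
  next
    fix n m k :: nat and \<sigma> \<tau> x y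
    assume a: "n \<ge> 1" "m \<ge> 1" "k \<in> {1..n}" "\<sigma> permutes {1..n}" "\<tau> permutes {1..m}"
      "x \<in> elts R n" "y \<in> elts R m"
    then obtain x' y' where p: "x' \<in> elts P n" "y' \<in> elts P m"
      and e: "x = \<phi> n x'" "y = \<phi> m y'" using im by auto
    have "n + m - 1 \<ge> 1" using a(1,2) by simp
    moreover have "\<sigma> k \<in> {1..n}" using a permutes_in_image by metis
    moreover have "perm_comp m k \<sigma> \<tau> permutes {1..n + m - 1}" using a by (intro perm_comp_permutes)
    ultimately show "ocomp R n m (\<sigma> k) (oact R n \<sigma> x) (oact R m \<tau> y)
         = oact R (n + m - 1) (perm_comp m k \<sigma> \<tau>) (ocomp R n m k x y)"
      using a p dom.equivariance[OF a(1-5) p]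
      by (simp only: e act comp dom.act_closed dom.comp_closed)
  next
    fix n m k :: nat and x y
    assume a: "n \<ge> 1" "m \<ge> 1" "k \<in> {1..n}" "x \<in> elts R n" "y \<in> elts R m"
    then have "n + m - 1 \<ge> 1" by linarith
    then show "ocomp R n m k x y \<in> elts R (n + m - 1)"
      using a comp dom.comp_closed by (auto simp only: im)
  next
    fix n and x assume a: "n \<ge> (1::nat)" "x \<in> elts R n"
    then obtain x' where p: "x' \<in> elts P n" "x = \<phi> n x'" using im by auto
    show "ocomp R 1 n 1 (ounit R) x = x"
      using comp[of 1 n 1 "ounit P" x'] dom.unit_left[of n x'] dom.unit_closed p a unit by simp
  next
    fix n k and x assume a: "n \<ge> (1::nat)" "k \<in> {1..n}" "x \<in> elts R n"
    then obtain x' where p: "x' \<in> elts P n" "x = \<phi> n x'" using im by auto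
    show "ocomp R n 1 k x (ounit R) = x"
      using comp[of n 1 k x' "ounit P"] dom.unit_right[of n k x'] dom.unit_closed p a unit by simp
  qed (auto simp: im act dom.act_closed dom.act_id dom.act_comp permutes_compose unit dom.unit_closed[simplified])
  then show ?thesis
    using assms by (intro operad_iso.intro operad_iso_axioms.intro) auto
qed

section \<open>Faces of a composite complex\<close>

text \<open>
  A face of a join decomposes uniquely along consecutive intervals. The \<open>i\<close>-th interval starts after the
  total size of the preceding factors.
\<close>

lemma mem_joins_iff:
  assumes "\<And>n K. (n, K) \<in> set Ks \<Longrightarrow> K \<subseteq> Pow {1..n}"
  shows "F \<in> joins Ks \<longleftrightarrow> F \<subseteq> {1..sum_list (map fst Ks)} \<and>
    (\<forall>i<length Ks. {p \<in> {1..fst (Ks ! i)}. p + sum_list (map fst (take i Ks)) \<in> F} \<in> snd (Ks ! i))"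
  using assms
proof (induction Ks arbitrary: F)
  case Nil
  then show ?case by auto
next
  case (Cons nK Ks)
  obtain n K where nK: "nK = (n, K)" by force
  let ?s = "sum_list (map fst Ks)"
  let ?at = "\<lambda>F i. {p \<in> {1..fst (Ks ! i)}. p + sum_list (map fst (take i Ks)) \<in> F} \<in> snd (Ks ! i)"
  let ?hd = "{p \<in> {1..n}. p \<in> F}" and ?tl = "{p \<in> {1..?s}. p + n \<in> F}"
  have K: "K \<subseteq> Pow {1..n}" using Cons.prems nK by auto
  have IH: "G \<in> joins Ks \<longleftrightarrow> G \<subseteq> {1..?s} \<and> (\<forall>i<length Ks. ?at G i)" for G
    by (rule Cons.IH) (use Cons.prems in auto)
  have size: "p + sum_list (map fst (take i Ks)) \<le> ?s" if "i < length Ks" "p \<le> fst (Ks ! i)" for i p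
  proof -
    have "?s = sum_list (map fst (take i Ks)) + (fst (Ks ! i) + sum_list (map fst (drop (Suc i) Ks)))"
      using that(1) by (metis id_take_nth_drop list.simps(9) map_append sum_list.Cons sum_list_append)
    then show ?thesis using that by simp
  qed
  have tl: "?at ?tl i \<longleftrightarrow> {p \<in> {1..fst (Ks ! i)}. p + (n + sum_list (map fst (take i Ks))) \<in> F} \<in> snd (Ks ! i)"
    if "i < length Ks" for i
  proof -
    have "{p \<in> {1..fst (Ks ! i)}. p + sum_list (map fst (take i Ks)) \<in> ?tl}
      = {p \<in> {1..fst (Ks ! i)}. p + (n + sum_list (map fst (take i Ks))) \<in> F}"
      using size[OF that] by (auto simp: ac_simps)
    then show ?thesis by simp
  qed
  have "F \<in> joins (nK # Ks) \<longleftrightarrow> F \<subseteq> {1..n + ?s} \<and> ?hd \<in> K \<and> ?tl \<in> joins Ks"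
  proof
    assume "F \<in> joins (nK # Ks)"
    then obtain I J where F: "F = I \<union> shift J n" "I \<in> K" "J \<in> joins Ks"
      by (auto simp: nK join_def)
    then have "I \<subseteq> {1..n}" "J \<subseteq> {1..?s}" using K IH by auto
    then have "F \<subseteq> {1..n + ?s}" "?hd = I" "?tl = J" by (auto simp: F(1) shift_def)
    then show "F \<subseteq> {1..n + ?s} \<and> ?hd \<in> K \<and> ?tl \<in> joins Ks" using F by simp
  next
    assume r: "F \<subseteq> {1..n + ?s} \<and> ?hd \<in> K \<and> ?tl \<in> joins Ks"
    have "F = ?hd \<union> shift ?tl n"
    proof (intro equalityI subsetI)
      fix p assume "p \<in> F"
      moreover from this r have "p \<in> {1..n + ?s}" by blast
      ultimately show "p \<in> ?hd \<union> shift ?tl n"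
        by (cases "p \<le> n") (auto simp: shift_def intro!: image_eqI[of p _ "p - n"])
    qed (auto simp: shift_def)
    then show "F \<in> joins (nK # Ks)" using r by (auto simp: nK join_def)
  qed
  then show ?case
    unfolding IH using tl by (auto simp: nK All_less_Suc2)
qed

definition outer_part :: "nat \<Rightarrow> nat \<Rightarrow> nat \<Rightarrow> nat set \<Rightarrow> nat set" where
  "outer_part n m k F = {i \<in> {1..n}. i \<noteq> k \<and> outer_pos m k i \<in> F}"

definition block_part :: "nat \<Rightarrow> nat \<Rightarrow> nat set \<Rightarrow> nat set" where
  "block_part m k F = {j \<in> {1..m}. j + k - 1 \<in> F}"

definition glue :: "nat \<Rightarrow> nat \<Rightarrow> nat set \<Rightarrow> nat set \<Rightarrow> nat set" where
  "glue m k I B = below I k \<union> shift B (k - 1) \<union> shift (above I k) (m - 1)"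

text \<open>
  For \<open>j \<noteq> k\<close> the factor of a vertex \<open>j \<in> I\<close> also contains the empty face, so the outer part of
  \<open>F\<close> is only required to be contained in \<open>I\<close>.
\<close>

lemma mem_joins_join_factor_iff:
  assumes "k \<in> {1..n}" "m \<ge> 1" "M \<subseteq> Pow {1..m}" "N \<subseteq> Pow {1..m}"
  shows "F \<in> joins (map (join_factor m k M N I) [1..<Suc n]) \<longleftrightarrow>
    F \<subseteq> {1..n + m - 1} \<and> block_part m k F \<in> (if k \<in> I then M else N) \<and> outer_part n m k F \<subseteq> I"
proof -
  let ?Ks = "map (join_factor m k M N I) [1..<Suc n]"
  let ?off = "\<lambda>i. sum_list (map fst (take i ?Ks))"
  \<comment> \<open>The factors with numbers \<open>1, \<dots>, i\<close> have size \<open>1\<close> each, except for the one of size \<open>m\<close> if \<open>k \<le> i\<close>.\<close>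
  have off: "?off i = (if i < k then i else i + m - 1)" if "i \<le> n" for i
  proof -
    have "sum_list (map (fst \<circ> join_factor m k M N I) [1..<Suc i]) = (if i < k then i else i + m - 1)"
      using assms(1,2) by (induction i) (auto simp: join_factor_def)
    moreover have "take i ?Ks = map (join_factor m k M N I) [1..<Suc i]"
      using that by (simp add: take_map take_upt del: upt_Suc)
    ultimately show ?thesis by (simp del: upt_Suc)
  qed
  have len: "length ?Ks = n" by simp
  have total: "sum_list (map fst ?Ks) = n + m - 1"
    using off[of n] assms by (simp del: upt_Suc)
  have nth: "?Ks ! i = join_factor m k M N I (Suc i)" if "i < n" for i
    using that by (simp del: upt_Suc)
  have factor: "{p \<in> {1..fst (?Ks ! i)}. p + ?off i \<in> F} \<in> snd (?Ks ! i) \<longleftrightarrow>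
      (if Suc i = k then block_part m k F \<in> (if k \<in> I then M else N)
       else outer_pos m k (Suc i) \<in> F \<longrightarrow> Suc i \<in> I)" if "i < n" for i
  proof (cases "Suc i = k")
    case True
    then have "?off i = k - 1" using that off[of i] by auto
    then have "{p \<in> {1..m}. p + ?off i \<in> F} = block_part m k F"
      using assms by (auto simp: block_part_def)
    then show ?thesis using that True by (simp only: nth join_factor_def) auto
  next
    case False
    then have "1 + ?off i = outer_pos m k (Suc i)"
      using that off[of i] assms by (auto simp: outer_pos_def)
    moreover have "{p \<in> {1..1::nat}. p + ?off i \<in> F} = (if 1 + ?off i \<in> F then {1} else {})" by auto
    ultimately show ?thesis using that False by (simp only: nth join_factor_def) auto
  qed
  have faces: "K \<subseteq> Pow {1..r}" if rK: "(r, K) \<in> set ?Ks" for r K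
  proof -
    obtain j where "(r, K) = join_factor m k M N I j" using rK by (auto simp del: upt_Suc)
    then show ?thesis using assms(3,4) by (cases "j = k"; cases "j \<in> I") (auto simp: join_factor_def simp del: atLeastAtMost_iff)
  qed
  have "F \<in> joins ?Ks \<longleftrightarrow> F \<subseteq> {1..n + m - 1} \<and>
      (\<forall>i<n. if Suc i = k then block_part m k F \<in> (if k \<in> I then M else N)
       else outer_pos m k (Suc i) \<in> F \<longrightarrow> Suc i \<in> I)"
    using mem_joins_iff[of ?Ks F, OF faces] factor unfolding len total by blast
  also have "\<dots> \<longleftrightarrow> F \<subseteq> {1..n + m - 1} \<and>
      (\<forall>i\<in>{1..n}. if i = k then block_part m k F \<in> (if k \<in> I then M else N)
       else outer_pos m k i \<in> F \<longrightarrow> i \<in> I)"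
    by (simp only: image_Suc_lessThan[symmetric] ball_simps lessThan_iff Ball_def[of "{..<n}"])
  also have "\<dots> \<longleftrightarrow> F \<subseteq> {1..n + m - 1} \<and>
      block_part m k F \<in> (if k \<in> I then M else N) \<and> outer_part n m k F \<subseteq> I"
    using assms(1) by (auto simp: outer_part_def)
  finally show ?thesis .
qed

text \<open>
  The face \<open>I\<close> of the defining union can be eliminated: \<open>K\<close> is closed under subsets, so \<open>I\<close> can be shrunk
  to the outer part, together with \<open>k\<close> if \<open>k \<in> I\<close>. As \<open>N \<subseteq> M\<close>, dropping \<open>k\<close> is possible exactly
  when the block part is a face of \<open>N\<close>.
\<close>

lemma mem_rel_subst_iff:
  assumes "k \<in> {1..n}" "m \<ge> 1" "K \<in> scpx n" "(M, N) \<in> relscpx m"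
  shows "F \<in> rel_subst n m k K (M, N) \<longleftrightarrow> F \<subseteq> {1..n + m - 1} \<and> block_part m k F \<in> M \<and>
    outer_part n m k F \<union> (if block_part m k F \<in> N then {} else {k}) \<in> K"
proof -
  let ?B = "block_part m k F" and ?O = "outer_part n m k F"
  have MN: "M \<subseteq> Pow {1..m}" "N \<subseteq> Pow {1..m}" "N \<subseteq> M" using assms by (auto simp: relscpx_def scpx_def)
  have down: "J \<in> K" if "I \<in> K" "J \<subseteq> I" for I J using that assms by (auto simp: scpx_def)
  have k: "k \<notin> ?O" by (simp add: outer_part_def)
  have "F \<in> rel_subst n m k K (M, N) \<longleftrightarrow>
      F \<subseteq> {1..n + m - 1} \<and> (\<exists>I\<in>K. ?B \<in> (if k \<in> I then M else N) \<and> ?O \<subseteq> I)"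
    using mem_joins_join_factor_iff[OF assms(1,2) MN(1,2)] by (auto simp: rel_subst_def simp del: upt_Suc)
  also have "(\<exists>I\<in>K. ?B \<in> (if k \<in> I then M else N) \<and> ?O \<subseteq> I) \<longleftrightarrow>
      ?B \<in> M \<and> ?O \<union> (if ?B \<in> N then {} else {k}) \<in> K"
  proof
    assume "\<exists>I\<in>K. ?B \<in> (if k \<in> I then M else N) \<and> ?O \<subseteq> I"
    then obtain I where "I \<in> K" "?B \<in> (if k \<in> I then M else N)" "?O \<subseteq> I" by blast
    then show "?B \<in> M \<and> ?O \<union> (if ?B \<in> N then {} else {k}) \<in> K"
      using MN(3) by (auto intro: down split: if_splits)
  next
    assume r: "?B \<in> M \<and> ?O \<union> (if ?B \<in> N then {} else {k}) \<in> K"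
    then show "\<exists>I\<in>K. ?B \<in> (if k \<in> I then M else N) \<and> ?O \<subseteq> I"
      using k by (intro bexI[of _ "?O \<union> (if ?B \<in> N then {} else {k})"]) auto
  qed
  finally show ?thesis .
qed

text \<open>
  Passing to a smaller face shrinks both parts, and a block part in \<open>N\<close>
  stays in \<open>N\<close>. So the set whose membership in \<open>K\<close> is tested shrinks as well.
\<close>

lemma rel_subst_scpx:
  assumes "k \<in> {1..n}" "m \<ge> 1" "K \<in> scpx n" "(M, N) \<in> relscpx m"
  shows "rel_subst n m k K (M, N) \<in> scpx (n + m - 1)"
proof -
  have "F' \<in> rel_subst n m k K (M, N)" if F: "F \<in> rel_subst n m k K (M, N)" "F' \<subseteq> F" for F F'
  proof -
    have sub: "block_part m k F' \<subseteq> block_part m k F" "outer_part n m k F' \<subseteq> outer_part n m k F"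
      using F(2) by (auto simp: block_part_def outer_part_def)
    have "block_part m k F \<in> N \<Longrightarrow> block_part m k F' \<in> N" "block_part m k F \<in> M \<Longrightarrow> block_part m k F' \<in> M"
      using sub assms(4) by (auto simp: relscpx_def scpx_def)
    moreover have "I \<in> K \<Longrightarrow> J \<subseteq> I \<Longrightarrow> J \<in> K" for I J using assms(3) by (auto simp: scpx_def)
    moreover have "outer_part n m k F' \<union> (if block_part m k F' \<in> N then {} else {k})
        \<subseteq> outer_part n m k F \<union> (if block_part m k F \<in> N then {} else {k})"
      using sub calculation(1) by auto
    ultimately show ?thesis using F unfolding mem_rel_subst_iff[OF assms] by blast
  qed
  moreover have "rel_subst n m k K (M, N) \<subseteq> Pow {1..n + m - 1}"
    using mem_rel_subst_iff[OF assms] by blast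
  ultimately show ?thesis unfolding scpx_def by blast
qed

lemma rel_subst_mono: "L \<subseteq> K \<Longrightarrow> rel_subst n m k L MN \<subseteq> rel_subst n m k K MN"
  by (auto simp: rel_subst_def)

section \<open>Relative complexes as three-valued functions\<close>

datatype zone = Inner | Middle | Outside

definition zone_of :: "nat set set \<times> nat set set \<Rightarrow> nat set \<Rightarrow> zone" where
  "zone_of KL F = (if F \<in> snd KL then Inner else if F \<in> fst KL then Middle else Outside)"

text \<open>
  Vertices with value \<open>Middle\<close> form the face whose zone is taken. The absorbing value \<open>Outside\<close> accounts
  for a block part that is no face of \<open>M\<close>: then no face of the composite results, whatever the outer part.
\<close>

definition zone_fun :: "nat \<Rightarrow> nat set set \<times> nat set set \<Rightarrow> (nat \<Rightarrow> zone) \<Rightarrow> zone" where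
  "zone_fun n KL v =
     (if \<exists>i\<in>{1..n}. v i = Outside then Outside else zone_of KL {i \<in> {1..n}. v i \<noteq> Inner})"

lemma zone_fun_local:
  assumes "\<And>i. i \<in> {1..n} \<Longrightarrow> v i = w i"
  shows "zone_fun n KL v = zone_fun n KL w"
proof -
  have "{i \<in> {1..n}. v i \<noteq> Inner} = {i \<in> {1..n}. w i \<noteq> Inner}" using assms by auto
  then show ?thesis using assms by (auto simp: zone_fun_def)
qed

text \<open>
  Evaluation at the \<open>Middle\<close>/\<open>Inner\<close> indicator of \<open>F\<close> recovers the zone of \<open>F\<close>, and the zones
  recover the pair because \<open>L \<subseteq> K\<close>.
\<close>

lemma zone_fun_inj: "inj_on (zone_fun n) (relscpx n)"
proof (rule inj_onI)
  fix x y assume xy: "x \<in> relscpx n" "y \<in> relscpx n" "zone_fun n x = zone_fun n y"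
  have zone: "zone_of x F = zone_of y F" if "F \<subseteq> {1..n}" for F
  proof -
    define v where "v i = (if i \<in> F then Middle else Inner)" for i
    have "{i \<in> {1..n}. v i \<noteq> Inner} = F" using that by (auto simp: v_def)
    moreover have "\<not> (\<exists>i\<in>{1..n}. v i = Outside)" by (simp add: v_def)
    ultimately show ?thesis using fun_cong[OF xy(3), of v] by (simp add: zone_fun_def)
  qed
  have sub: "snd z \<subseteq> fst z" "fst z \<subseteq> Pow {1..n}" if "z \<in> relscpx n" for z
    using that by (auto simp: relscpx_def scpx_def)
  have iff: "(F \<in> snd x \<longleftrightarrow> F \<in> snd y) \<and> (F \<in> fst x \<longleftrightarrow> F \<in> fst y)" for F
  proof (cases "F \<subseteq> {1..n}")
    case True
    then show ?thesis using zone[OF True] sub(1)[OF xy(1)] sub(1)[OF xy(2)]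
      by (auto simp: zone_of_def split: if_splits)
  next
    case False
    then show ?thesis using sub[OF xy(1)] sub[OF xy(2)] by auto
  qed
  then show "x = y" by (intro prod_eqI) auto
qed

lemma mem_relabel_iff:
  assumes "inj \<sigma>"
  shows "\<sigma> ` G \<in> relabel \<sigma> K \<longleftrightarrow> G \<in> K"
  by (auto simp: relabel_def inj_image_eq_iff[OF assms])

lemma zone_fun_relabel:
  assumes "\<sigma> permutes {1..n}"
  shows "zone_fun n (relabel \<sigma> K, relabel \<sigma> L) v = zone_fun n (K, L) (v \<circ> \<sigma>)"
proof -
  have "{i \<in> {1..n}. v i \<noteq> Inner} = \<sigma> ` {i \<in> {1..n}. (v \<circ> \<sigma>) i \<noteq> Inner}"
    by (subst (1) permutes_image[OF assms, symmetric]) auto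
  moreover have "(\<exists>i\<in>{1..n}. v i = Outside) \<longleftrightarrow> (\<exists>i\<in>{1..n}. (v \<circ> \<sigma>) i = Outside)"
    by (subst permutes_image[OF assms, symmetric]) auto
  ultimately show ?thesis
    by (simp add: zone_fun_def zone_of_def mem_relabel_iff[OF permutes_inj[OF assms]])
qed

lemma relabel_scpx:
  assumes "\<sigma> permutes {1..n}" "K \<in> scpx n"
  shows "relabel \<sigma> K \<in> scpx n"
proof -
  have "J \<in> relabel \<sigma> K" if J: "J \<subseteq> \<sigma> ` I" "I \<in> K" for I J
  proof -
    obtain I' where "I' \<subseteq> I" "J = \<sigma> ` I'" using J(1) by (auto simp: subset_image_iff)
    then show ?thesis using assms(2) J(2) by (auto simp: relabel_def scpx_def)
  qed
  moreover have "\<sigma> ` I \<subseteq> {1..n}" if "I \<in> K" for I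
    using that assms permutes_image[OF assms(1)] by (auto simp: scpx_def)
  ultimately have "relabel \<sigma> K \<subseteq> Pow {1..n}"
      "\<forall>I'\<in>relabel \<sigma> K. \<forall>J. J \<subseteq> I' \<longrightarrow> J \<in> relabel \<sigma> K"
    unfolding relabel_def by blast+
  then show ?thesis by (simp add: scpx_def)
qed

text \<open>
  If the block part \<open>B\<close> is in zone \<open>Inner\<close>, \<open>Middle\<close> or \<open>Outside\<close> of \<open>(M, N)\<close>, then in
  \<open>mem_rel_subst_iff\<close> the vertex \<open>k\<close> is absent, present, or the test fails. This is the effect of
  assigning the zone of \<open>B\<close> to the argument \<open>k\<close> of \<open>zone_fun n (K, L)\<close>.
\<close>

lemma zone_fun_rel_subst:
  assumes k: "k \<in> {1..n}" "m \<ge> 1" and KL: "(K, L) \<in> relscpx n" and MN: "(M, N) \<in> relscpx m"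
  shows "zone_fun (n + m - 1) (rel_subst n m k K (M, N), rel_subst n m k L (M, N)) v
    = zone_fun n (K, L) (\<lambda>i. if i = k then zone_fun m (M, N) (\<lambda>j. v (j + k - 1))
        else v (outer_pos m k i))" (is "_ = zone_fun n _ ?w")
proof (cases "\<exists>p\<in>{1..n + m - 1}. v p = Outside")
  case True
  then obtain p where p: "p \<in> {1..n + m - 1}" "v p = Outside" by blast
  from k have "k \<ge> 1" by simp
  then have "\<exists>i\<in>{1..n}. ?w i = Outside" using k(2)
  proof (cases rule: position_cases[of k m p])
    case (outer i)
    then have "i \<in> {1..n}" using p k outer_pos_in_range_iff by metis
    then show ?thesis using outer p by (intro bexI[of _ i]) auto
  next
    case (block j)
    then have "?w k = Outside" using p by (auto simp: zone_fun_def)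
    then show ?thesis using k by blast
  qed
  then show ?thesis using True by (simp add: zone_fun_def)
next
  case False
  define F where "F = {p \<in> {1..n + m - 1}. v p \<noteq> Inner}"
  have block: "{j \<in> {1..m}. v (j + k - 1) \<noteq> Inner} = block_part m k F"
    using block_pos_in_range[OF k(1)] by (auto simp: F_def block_part_def)
  have outer: "{i \<in> {1..n}. i \<noteq> k \<and> v (outer_pos m k i) \<noteq> Inner} = outer_part n m k F"
    using outer_pos_in_range_iff[OF k] by (auto simp: F_def outer_part_def)
  have not_block: "\<not> (\<exists>j\<in>{1..m}. v (j + k - 1) = Outside)"
    using False block_pos_in_range[OF k(1)] by blast
  have not_outer: "v (outer_pos m k i) \<noteq> Outside" if "i \<in> {1..n}" "i \<noteq> k" for i
    using False outer_pos_in_range_iff[OF k] that by blast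
  have wk: "?w k = zone_of (M, N) (block_part m k F)"
    unfolding zone_fun_def block using not_block by simp
  have sub: "N \<subseteq> M" "L \<subseteq> K" "K \<in> scpx n" "L \<in> scpx n" using KL MN by (auto simp: relscpx_def)
  have F: "F \<subseteq> {1..n + m - 1}" by (auto simp: F_def)
  have lhs: "zone_fun (n + m - 1) (rel_subst n m k K (M, N), rel_subst n m k L (M, N)) v
      = zone_of (rel_subst n m k K (M, N), rel_subst n m k L (M, N)) F"
    using False by (simp add: zone_fun_def F_def)
  show ?thesis
  proof (cases "block_part m k F \<in> M")
    case True
    have "?w k \<noteq> Outside" unfolding wk using True by (simp add: zone_of_def)
    then have ex: "\<not> (\<exists>i\<in>{1..n}. ?w i = Outside)" using not_outer by (metis (full_types))
    have "{i \<in> {1..n}. ?w i \<noteq> Inner}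
        = {i \<in> {1..n}. i \<noteq> k \<and> v (outer_pos m k i) \<noteq> Inner} \<union> (if ?w k = Inner then {} else {k})"
      using k by auto
    also have "\<dots> = outer_part n m k F \<union> (if block_part m k F \<in> N then {} else {k})"
      unfolding wk outer by (simp add: zone_of_def)
    finally have "zone_fun n (K, L) ?w
        = zone_of (K, L) (outer_part n m k F \<union> (if block_part m k F \<in> N then {} else {k}))"
      using ex by (simp only: zone_fun_def if_False)
    also have "\<dots> = zone_of (rel_subst n m k K (M, N), rel_subst n m k L (M, N)) F"
      unfolding zone_of_def fst_conv snd_conv
        mem_rel_subst_iff[OF k sub(3) MN] mem_rel_subst_iff[OF k sub(4) MN]
      using F True by simp
    finally show ?thesis unfolding lhs ..
  next
    case False
    then have "?w k = Outside" unfolding wk using sub by (auto simp: zone_of_def)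
    then have "zone_fun n (K, L) ?w = Outside" using k unfolding zone_fun_def by auto
    moreover have "zone_of (rel_subst n m k K (M, N), rel_subst n m k L (M, N)) F = Outside"
      unfolding zone_of_def fst_conv snd_conv
        mem_rel_subst_iff[OF k sub(3) MN] mem_rel_subst_iff[OF k sub(4) MN]
      using False by simp
    ultimately show ?thesis unfolding lhs by simp
  qed
qed

lemma relscpx_operad_simps:
  "elts relscpx_operad = relscpx"
  "oact relscpx_operad n \<sigma> (K, L) = (relabel \<sigma> K, relabel \<sigma> L)"
  "ocomp relscpx_operad n m k (K, L) MN = (rel_subst n m k K MN, rel_subst n m k L MN)"
  "ounit relscpx_operad = ({{}, {1}}, {{}})"
  by (auto simp: relscpx_operad_def)

lemma operad_relscpx: "operad relscpx_operad"
proof (rule operad_of_faithful_representation[where ev = zone_fun], unfold relscpx_operad_simps)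
  fix n m k :: nat and x y :: "nat set set \<times> nat set set" and v :: "nat \<Rightarrow> zone"
  assume a: "n \<ge> 1" "m \<ge> 1" "k \<in> {1..n}" "x \<in> relscpx n" "y \<in> relscpx m"
  obtain K L M N where e: "x = (K, L)" "y = (M, N)" by (cases x, cases y)
  have xy: "(K, L) \<in> relscpx n" "(M, N) \<in> relscpx m" using a e by simp_all
  then have KL: "K \<in> scpx n" "L \<in> scpx n" "L \<subseteq> K" by (auto simp: relscpx_def)
  show "ocomp relscpx_operad n m k x y \<in> relscpx (n + m - 1)"
    unfolding e relscpx_operad_simps relscpx_def
    using rel_subst_scpx[OF a(3,2) KL(1) xy(2)] rel_subst_scpx[OF a(3,2) KL(2) xy(2)]
      rel_subst_mono[OF KL(3)] by simp
  show "zone_fun (n + m - 1) (ocomp relscpx_operad n m k x y) v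
      = zone_fun n x (\<lambda>i. if i = k then zone_fun m y (\<lambda>j. v (j + k - 1)) else v (outer_pos m k i))"
    unfolding e relscpx_operad_simps by (rule zone_fun_rel_subst[OF a(3,2) xy])
next
  fix n :: nat and \<sigma> and x :: "nat set set \<times> nat set set"
  assume a: "n \<ge> 1" "\<sigma> permutes {1..n}" "x \<in> relscpx n"
  obtain K L where e: "x = (K, L)" by (cases x)
  have "relabel \<sigma> L \<subseteq> relabel \<sigma> K" using a(3) by (auto simp: e relscpx_def relabel_def)
  then show "oact relscpx_operad n \<sigma> x \<in> relscpx n"
    using a(3) relabel_scpx[OF a(2)] by (simp add: e relscpx_operad_simps relscpx_def)
  show "zone_fun n (oact relscpx_operad n \<sigma> x) v = zone_fun n x (v \<circ> \<sigma>)" for v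
    unfolding e relscpx_operad_simps by (rule zone_fun_relabel[OF a(2)])
next
  show "({{}, {1}}, {{}}) \<in> relscpx 1"
    by (auto simp: relscpx_def scpx_def)
  have "{i \<in> {1..1}. v i \<noteq> Inner} = (if v 1 = Inner then {} else {1::nat})" for v :: "nat \<Rightarrow> zone"
    by auto
  then show "zone_fun 1 ({{}, {1}}, {{}}) v = v 1" for v
    by (cases "v 1") (simp_all add: zone_fun_def zone_of_def)
next
  show "inj_on (zone_fun n) (relscpx n)" for n by (rule zone_fun_inj)
next
  show "zone_fun n x v = zone_fun n x w" if "\<And>i. i \<in> {1..n} \<Longrightarrow> v i = w i" for n x v w
    by (rule zone_fun_local) (rule that)
qed

section \<open>The two suboperads\<close>

lemma mem_glue_iff:
  "p \<in> glue m k I B \<longleftrightarrow> (\<exists>i\<in>I. i \<noteq> k \<and> p = outer_pos m k i) \<or> (\<exists>j\<in>B. p = j + (k - 1))"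
  if "m \<ge> 1"
proof -
  have "outer_pos m k i = i + (m - 1)" if "i > k" for i
    using that \<open>m \<ge> 1\<close> by (simp add: outer_pos_def)
  then have "p \<in> shift (above I k) (m - 1) \<longleftrightarrow> (\<exists>i\<in>I. i > k \<and> p = outer_pos m k i)"
    unfolding shift_def above_def by (simp add: image_iff) metis
  moreover have "p \<in> below I k \<longleftrightarrow> (\<exists>i\<in>I. i < k \<and> p = outer_pos m k i)"
    by (auto simp: below_def outer_pos_def)
  moreover have "p \<in> shift B (k - 1) \<longleftrightarrow> (\<exists>j\<in>B. p = j + (k - 1))" by (auto simp: shift_def)
  ultimately show ?thesis by (auto simp: glue_def neq_iff)
qed

text \<open>
  Together with \<open>parts_glue\<close>, this identifies faces of a composite with pairs consisting of an outer
  part avoiding \<open>k\<close> and a block part. The faces \<open>I \<circ>\<^sub>k J\<close> and \<open>I \<circ>\<^sub>k\<^sup>c J\<close> are both obtained by gluing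
  (\<open>face_subst_eq_glue\<close>, \<open>face_comp_eq_glue\<close>), so they can be compared with \<open>mem_rel_subst_iff\<close>.
\<close>

lemma glue_parts:
  assumes "k \<in> {1..n}" "m \<ge> 1" "F \<subseteq> {1..n + m - 1}"
  shows "glue m k (outer_part n m k F) (block_part m k F) = F"
proof (intro equalityI subsetI)
  fix p assume "p \<in> glue m k (outer_part n m k F) (block_part m k F)"
  then show "p \<in> F" using assms(1,2) by (auto simp: mem_glue_iff outer_part_def block_part_def)
next
  fix p assume p: "p \<in> F"
  then have r: "p \<in> {1..n + m - 1}" using assms by blast
  have "k \<ge> 1" using assms by simp
  then show "p \<in> glue m k (outer_part n m k F) (block_part m k F)" using assms(2)
  proof (cases rule: position_cases[of k m p])
    case (outer i)
    then have "i \<in> outer_part n m k F"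
      using p r outer_pos_in_range_iff[OF assms(1,2)] by (simp add: outer_part_def)
    then show ?thesis using outer assms by (auto simp: mem_glue_iff)
  next
    case (block j)
    then have "j \<in> block_part m k F" "p = j + (k - 1)" using p \<open>k \<ge> 1\<close> by (auto simp: block_part_def)
    then show ?thesis using assms(2) by (auto simp: mem_glue_iff)
  qed
qed

lemma parts_glue:
  assumes k: "k \<in> {1..n}" "m \<ge> 1" and I: "I \<subseteq> {1..n}" and B: "B \<subseteq> {1..m}"
  shows "glue m k I B \<subseteq> {1..n + m - 1}"
    and "outer_part n m k (glue m k I B) = I - {k}"
    and "block_part m k (glue m k I B) = B"
proof -
  have k1: "k \<ge> 1" and kj: "j + (k - 1) = j + k - 1" for j using k by auto
  have sep: "outer_pos m k i \<noteq> j + k - 1" if "i \<noteq> k" "j \<in> B" for i j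
    using outer_pos_neq_block_pos[OF k1 that(1)] that(2) B by blast
  show "glue m k I B \<subseteq> {1..n + m - 1}"
  proof
    fix p assume "p \<in> glue m k I B"
    then show "p \<in> {1..n + m - 1}"
      using I B outer_pos_in_range_iff[OF k] block_pos_in_range[OF k(1)]
      unfolding mem_glue_iff[OF k(2)] kj by blast
  qed
  have "outer_pos m k i \<in> glue m k I B \<longleftrightarrow> i \<in> I" if "i \<noteq> k" for i
    unfolding mem_glue_iff[OF k(2)] kj using that sep outer_pos_eq_iff[OF k(2)] by blast
  then show "outer_part n m k (glue m k I B) = I - {k}" using I by (auto simp: outer_part_def)
  have "j + k - 1 \<in> glue m k I B \<longleftrightarrow> j \<in> B" if "j \<in> {1..m}" for j
  proof -
    have "j + k - 1 \<noteq> outer_pos m k i" if "i \<noteq> k" for i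
      using outer_pos_neq_block_pos[OF k1 that \<open>j \<in> {1..m}\<close>] by simp
    moreover have "j + k - 1 = j' + k - 1 \<longleftrightarrow> j = j'" for j' using k1 by auto
    ultimately show ?thesis unfolding mem_glue_iff[OF k(2)] kj by metis
  qed
  then show "block_part m k (glue m k I B) = B" using B by (auto simp: block_part_def)
qed

lemma glue_mono: "I \<subseteq> I' \<Longrightarrow> B \<subseteq> B' \<Longrightarrow> glue m k I B \<subseteq> glue m k I' B'"
  by (auto simp: glue_def below_def above_def shift_def)

lemma glue_remove: "glue m k (I - {k}) B = glue m k I B"
  by (auto simp: glue_def below_def above_def shift_def)

lemma face_subst_eq_glue: "face_subst m k I J = glue m k I (if k \<in> I then J else {})"
  by (simp add: face_subst_def glue_def shift_def)

lemma face_comp_eq_glue: "face_comp m k I J = glue m k I (if k \<in> I then {1..m} else J)"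
  by (simp add: face_comp_def glue_def)

text \<open>
  Given a face \<open>F\<close> of the left side, take \<open>J\<close> to be its block part, and \<open>I\<close> its outer part with
  \<open>k\<close> added if \<open>J\<close> is nonempty. Conversely, for \<open>F = I \<circ>\<^sub>k J\<close> with \<open>k \<in> I\<close> but \<open>J\<close> empty,
  the criterion tests \<open>I - {k}\<close>, which is in \<open>K\<close> by closure under subsets.
\<close>

lemma rel_subst_empty_face_right:
  assumes k: "k \<in> {1..n}" "m \<ge> 1" and K: "K \<in> scpx n" and M: "(M, {{}}) \<in> relscpx m"
  shows "rel_subst n m k K (M, {{}}) = scpx_subst m k K M"
proof (intro equalityI subsetI)
  fix F assume "F \<in> rel_subst n m k K (M, {{}})"
  then have F: "F \<subseteq> {1..n + m - 1}" "block_part m k F \<in> M"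
      "outer_part n m k F \<union> (if block_part m k F = {} then {} else {k}) \<in> K" (is "?I \<in> K")
    using mem_rel_subst_iff[OF k K M] by auto
  have k_notin: "k \<notin> outer_part n m k F" by (simp add: outer_part_def)
  have "F = glue m k (outer_part n m k F) (block_part m k F)" using glue_parts[OF k F(1)] by simp
  also have "\<dots> = glue m k (?I - {k}) (block_part m k F)" using k_notin by simp
  also have "\<dots> = glue m k ?I (if k \<in> ?I then block_part m k F else {})"
    unfolding glue_remove using k_notin by auto
  also have "\<dots> = face_subst m k ?I (block_part m k F)" by (rule face_subst_eq_glue[symmetric])
  finally show "F \<in> scpx_subst m k K M" using F(2,3) unfolding scpx_subst_def by blast
next
  fix F assume "F \<in> scpx_subst m k K M"
  then obtain I J where IJ: "F = face_subst m k I J" "I \<in> K" "J \<in> M" by (auto simp: scpx_subst_def)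
  define B where "B = (if k \<in> I then J else {})"
  have M': "{} \<in> M" "M \<in> scpx m" using M by (auto simp: relscpx_def)
  have sub: "I \<subseteq> {1..n}" "B \<subseteq> {1..m}" using IJ K M' by (auto simp: scpx_def B_def)
  have F: "F = glue m k I B" by (simp add: IJ face_subst_eq_glue B_def)
  have "I - {k} \<union> (if B = {} then {} else {k}) \<subseteq> I" by (auto simp: B_def)
  then have "I - {k} \<union> (if B = {} then {} else {k}) \<in> K" using IJ K unfolding scpx_def by blast
  moreover have "B \<in> M" using IJ M' by (simp add: B_def)
  ultimately show "F \<in> rel_subst n m k K (M, {{}})"
    unfolding mem_rel_subst_iff[OF k K M] F parts_glue(2,3)[OF k sub]
    using parts_glue(1)[OF k sub] by simp
qed

lemma rel_subst_empty_face_left: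
  assumes k: "k \<in> {1..n}" "m \<ge> 1" and M: "(M, {{}}) \<in> relscpx m"
  shows "rel_subst n m k {{}} (M, {{}}) = {{}}"
proof -
  have "{{}} \<in> scpx n" "{} \<in> M" using M by (auto simp: scpx_def relscpx_def)
  then show ?thesis
    using rel_subst_empty_face_right[OF k _ M, of "{{}}"]
    by (auto simp: scpx_subst_def face_subst_def below_def above_def shift_def)
qed

text \<open>
  If the block part of \<open>F\<close> is not in \<open>N\<close>, then \<open>F\<close> lies below \<open>I \<circ>\<^sub>k\<^sup>c J\<close> with \<open>I\<close> the outer part together
  with \<open>k\<close>, and any \<open>J \<in> N\<close>; this choice of \<open>J\<close> is where \<open>N \<noteq> {}\<close> enters. For empty \<open>N\<close> the right side
  would be empty.
\<close>

lemma rel_subst_full_simplex_right: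
  assumes k: "k \<in> {1..n}" "m \<ge> 1" and K: "K \<in> scpx n"
    and N: "(full_simplex m, N) \<in> relscpx m" "N \<noteq> {}"
  shows "rel_subst n m k K (full_simplex m, N) = scpx_comp m k K N"
proof (intro equalityI subsetI)
  fix F assume "F \<in> rel_subst n m k K (full_simplex m, N)"
  then have F: "F \<subseteq> {1..n + m - 1}" "block_part m k F \<subseteq> {1..m}"
      "outer_part n m k F \<union> (if block_part m k F \<in> N then {} else {k}) \<in> K"
    using mem_rel_subst_iff[OF k K N(1)] by (auto simp: full_simplex_def simp del: atLeastAtMost_iff)
  have k_notin: "k \<notin> outer_part n m k F" by (simp add: outer_part_def)
  have glue: "F = glue m k (outer_part n m k F) (block_part m k F)" using glue_parts[OF k F(1)] by simp
  show "F \<in> scpx_comp m k K N"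
  proof (cases "block_part m k F \<in> N")
    case True
    then have "F \<subseteq> face_comp m k (outer_part n m k F) (block_part m k F)"
      using k_notin glue by (simp add: face_comp_eq_glue)
    then show ?thesis using True F(3) by (auto simp: scpx_comp_def)
  next
    case False
    obtain J where "J \<in> N" using N(2) by blast
    have "F \<subseteq> glue m k (outer_part n m k F \<union> {k}) {1..m}"
      by (subst glue, rule glue_mono) (use F(2) in auto)
    then have "F \<subseteq> face_comp m k (outer_part n m k F \<union> {k}) J" by (simp add: face_comp_eq_glue)
    then show ?thesis using False F(3) \<open>J \<in> N\<close> unfolding scpx_comp_def by auto
  qed
next
  fix F assume "F \<in> scpx_comp m k K N"
  then obtain I J where IJ: "F \<subseteq> face_comp m k I J" "I \<in> K" "J \<in> N" by (auto simp: scpx_comp_def)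
  define B where "B = (if k \<in> I then {1..m} else J)"
  have N': "N \<in> scpx m" using N by (auto simp: relscpx_def)
  have sub: "I \<subseteq> {1..n}" "B \<subseteq> {1..m}" using IJ K N' by (auto simp: scpx_def B_def)
  have F: "F \<subseteq> glue m k I B" using IJ(1) by (simp add: face_comp_eq_glue B_def)
  have "outer_part n m k F \<subseteq> outer_part n m k (glue m k I B)"
      "block_part m k F \<subseteq> block_part m k (glue m k I B)"
    using F by (auto simp: outer_part_def block_part_def)
  then have parts: "outer_part n m k F \<subseteq> I - {k}" "block_part m k F \<subseteq> B"
    unfolding parts_glue(2,3)[OF k sub] .
  have "block_part m k F \<in> N" if "k \<notin> I"
    using that parts(2) IJ(3) N' by (auto simp: B_def scpx_def)
  then have "outer_part n m k F \<union> (if block_part m k F \<in> N then {} else {k}) \<subseteq> I" using parts(1) by auto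
  then have "outer_part n m k F \<union> (if block_part m k F \<in> N then {} else {k}) \<in> K"
    using IJ K unfolding scpx_def by blast
  moreover have "block_part m k F \<in> full_simplex m" using parts(2) sub(2) by (simp only: full_simplex_def Pow_iff)
  moreover have "F \<subseteq> {1..n + m - 1}" using F parts_glue(1)[OF k sub] by blast
  ultimately show "F \<in> rel_subst n m k K (full_simplex m, N)"
    unfolding mem_rel_subst_iff[OF k K N(1)] by blast
qed

lemma rel_subst_full_simplex_left:
  assumes k: "k \<in> {1..n}" "m \<ge> 1" and N: "(full_simplex m, N) \<in> relscpx m"
  shows "rel_subst n m k (full_simplex n) (full_simplex m, N) = full_simplex (n + m - 1)"
proof -
  have "full_simplex n \<in> scpx n" by (auto simp: full_simplex_def scpx_def)
  moreover have "block_part m k F \<in> full_simplex m" for F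
    by (auto simp: full_simplex_def block_part_def)
  moreover have "outer_part n m k F \<union> (if block_part m k F \<in> N then {} else {k}) \<in> full_simplex n" for F
    using k by (auto simp: full_simplex_def outer_part_def)
  ultimately have "F \<in> rel_subst n m k (full_simplex n) (full_simplex m, N) \<longleftrightarrow> F \<in> full_simplex (n + m - 1)" for F
    using mem_rel_subst_iff[OF k _ N] by (simp add: full_simplex_def)
  then show ?thesis by blast
qed

lemma scpx_ne_iff: "K \<in> scpx_ne n \<longleftrightarrow> K \<in> scpx n \<and> {} \<in> K"
  by (auto simp: scpx_ne_def scpx_def)

lemma rel_empty_face_iff: "x \<in> rel_empty_face n \<longleftrightarrow> (\<exists>K\<in>scpx_ne n. x = (K, {{}}))"
proof (cases x)
  case (Pair K L)
  have "{{}} \<in> scpx n" by (simp add: scpx_def)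
  then have "x \<in> rel_empty_face n \<longleftrightarrow> K \<in> scpx n \<and> {} \<in> K \<and> L = {{}}"
    unfolding Pair rel_empty_face_def relscpx_def by (simp cong: conj_cong) blast
  then show ?thesis by (simp add: Pair scpx_ne_iff)
qed

text \<open>
  Together with \<open>rel_empty_face_iff\<close>, this says that dropping the constant component is a bijection onto
  the nonempty complexes.
\<close>

lemma rel_in_simplex_iff: "x \<in> rel_in_simplex n \<longleftrightarrow> (\<exists>L\<in>scpx_ne n. x = (full_simplex n, L))"
proof (cases x)
  case (Pair K L)
  have "full_simplex n \<in> scpx n" by (auto simp: full_simplex_def scpx_def)
  moreover have "L \<subseteq> full_simplex n" if "L \<in> scpx n"
    using that by (simp add: full_simplex_def scpx_def)
  ultimately have "x \<in> rel_in_simplex n \<longleftrightarrow> K = full_simplex n \<and> L \<in> scpx n \<and> L \<noteq> {}"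
    unfolding Pair rel_in_simplex_def relscpx_def by auto
  then show ?thesis by (simp add: Pair scpx_ne_def)
qed

lemma relabel_full_simplex:
  assumes "\<sigma> permutes {1..n}"
  shows "relabel \<sigma> (full_simplex n) = full_simplex n"
  unfolding relabel_def full_simplex_def using permutes_image[OF assms] image_Pow_surj by metis

lemma relscpx_closed:
  shows "\<lbrakk>n \<ge> 1; \<sigma> permutes {1..n}; x \<in> relscpx n\<rbrakk> \<Longrightarrow> oact relscpx_operad n \<sigma> x \<in> relscpx n"
    and "\<lbrakk>n \<ge> 1; m \<ge> 1; k \<in> {1..n}; x \<in> relscpx n; y \<in> relscpx m\<rbrakk>
       \<Longrightarrow> ocomp relscpx_operad n m k x y \<in> relscpx (n + m - 1)"
  using operad.act_closed[OF operad_relscpx] operad.comp_closed[OF operad_relscpx]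
  by (simp_all add: relscpx_operad_simps(1))

lemma suboperad_rel_empty_face: "suboperad relscpx_operad rel_empty_face"
proof (intro suboperad.intro operad_relscpx suboperad_axioms.intro)
  fix n :: nat and \<sigma> x assume a: "n \<ge> 1" "\<sigma> permutes {1..n}" "x \<in> rel_empty_face n"
  then have "oact relscpx_operad n \<sigma> x \<in> relscpx n"
    using relscpx_closed(1) by (auto simp: rel_empty_face_def)
  then show "oact relscpx_operad n \<sigma> x \<in> rel_empty_face n"
    using a(3) by (auto simp: rel_empty_face_def relscpx_operad_simps relabel_def)
next
  fix n m k :: nat and x y
  assume a: "n \<ge> 1" "m \<ge> 1" "k \<in> {1..n}" "x \<in> rel_empty_face n" "y \<in> rel_empty_face m"
  obtain K M where e: "x = (K, {{}})" "y = (M, {{}})"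
    using a(4,5) by (auto simp: rel_empty_face_def)
  have xy: "x \<in> relscpx n" "y \<in> relscpx m" using a by (auto simp: rel_empty_face_def)
  then have "rel_subst n m k {{}} (M, {{}}) = {{}}"
    unfolding e using rel_subst_empty_face_left[OF a(3,2)] by blast
  then show "ocomp relscpx_operad n m k x y \<in> rel_empty_face (n + m - 1)"
    using relscpx_closed(2)[OF a(1-3) xy] by (simp add: e rel_empty_face_def relscpx_operad_simps)
next
  show "rel_empty_face n \<subseteq> elts relscpx_operad n" for n
    by (auto simp: rel_empty_face_def relscpx_operad_simps)
next
  have "{{}, {1}} \<in> scpx_ne 1" by (auto simp: scpx_ne_def scpx_def)
  then show "ounit relscpx_operad \<in> rel_empty_face 1"
    unfolding relscpx_operad_simps rel_empty_face_iff by (intro bexI[of _ "{{}, {1}}"] refl)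
qed

lemma suboperad_rel_in_simplex: "suboperad relscpx_operad rel_in_simplex"
proof (intro suboperad.intro operad_relscpx suboperad_axioms.intro)
  fix n :: nat and \<sigma> x assume a: "n \<ge> 1" "\<sigma> permutes {1..n}" "x \<in> rel_in_simplex n"
  then obtain L where e: "x = (full_simplex n, L)" and L: "L \<noteq> {}" and x: "x \<in> relscpx n"
    by (auto simp: rel_in_simplex_def)
  have "relabel \<sigma> L \<noteq> {}" using L by (simp add: relabel_def)
  then show "oact relscpx_operad n \<sigma> x \<in> rel_in_simplex n"
    using relscpx_closed(1)[OF a(1,2) x]
    by (simp add: e relscpx_operad_simps rel_in_simplex_def relabel_full_simplex[OF a(2)])
next
  fix n m k :: nat and x y
  assume a: "n \<ge> 1" "m \<ge> 1" "k \<in> {1..n}" "x \<in> rel_in_simplex n" "y \<in> rel_in_simplex m"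
  obtain L N where e: "x = (full_simplex n, L)" "y = (full_simplex m, N)"
    and ne: "L \<in> scpx_ne n" "N \<in> scpx_ne m"
    using a(4,5) by (auto simp: rel_in_simplex_iff)
  have xy: "x \<in> relscpx n" "y \<in> relscpx m" using a by (auto simp: rel_in_simplex_def)
  have L: "L \<in> scpx n" "{} \<in> L" and N: "{} \<in> N" using ne by (auto simp: scpx_ne_iff)
  have "{} \<in> rel_subst n m k L (full_simplex m, N)"
    using mem_rel_subst_iff[OF a(3,2) L(1) xy(2)[unfolded e], of "{}"] L N
    by (simp add: outer_part_def block_part_def full_simplex_def)
  then show "ocomp relscpx_operad n m k x y \<in> rel_in_simplex (n + m - 1)"
    using relscpx_closed(2)[OF a(1-3) xy] rel_subst_full_simplex_left[OF a(3,2) xy(2)[unfolded e]]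
    by (auto simp: e rel_in_simplex_def relscpx_operad_simps)
next
  show "rel_in_simplex n \<subseteq> elts relscpx_operad n" for n
    by (auto simp: rel_in_simplex_def relscpx_operad_simps)
next
  have "full_simplex 1 = {{}, {1}}" by (auto simp: full_simplex_def)
  moreover have "{{}} \<in> scpx_ne 1" by (auto simp: scpx_ne_def scpx_def)
  ultimately show "ounit relscpx_operad \<in> rel_in_simplex 1"
    unfolding relscpx_operad_simps rel_in_simplex_iff by (intro bexI[of _ "{{}}"]) simp_all
qed

lemma operad_iso_substitution:
  "operad_iso (restrict_operad relscpx_operad rel_empty_face) substitution_operad (\<lambda>n. fst)"
proof (rule operad_iso_of_bijection)
  show "operad (restrict_operad relscpx_operad rel_empty_face)"
    by (rule operad_restrict_suboperad[OF suboperad_rel_empty_face])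
next
  fix n m k :: nat and x y
  assume a: "n \<ge> 1" "m \<ge> 1" "k \<in> {1..n}"
    "x \<in> elts (restrict_operad relscpx_operad rel_empty_face) n"
    "y \<in> elts (restrict_operad relscpx_operad rel_empty_face) m"
  then have x: "x \<in> rel_empty_face n" and y: "y \<in> rel_empty_face m"
    by (simp_all add: restrict_operad_def)
  from x obtain K where e1: "x = (K, {{}})" and x': "x \<in> relscpx n" by (auto simp: rel_empty_face_def)
  from y obtain M where e2: "y = (M, {{}})" and y': "y \<in> relscpx m" by (auto simp: rel_empty_face_def)
  note e = e1 e2 and xy = x' y'
  have "K \<in> scpx n" "(M, {{}}) \<in> relscpx m"
    using xy unfolding e by (simp_all add: relscpx_def)
  then have "rel_subst n m k K (M, {{}}) = scpx_subst m k K M"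
    by (rule rel_subst_empty_face_right[OF a(3,2)])
  then show "ocomp substitution_operad n m k (fst x) (fst y)
    = fst (ocomp (restrict_operad relscpx_operad rel_empty_face) n m k x y)"
    by (simp add: e restrict_operad_def substitution_operad_def relscpx_operad_simps)
next
  fix n :: nat
  show "bij_betw fst (elts (restrict_operad relscpx_operad rel_empty_face) n) (elts substitution_operad n)"
    by (rule bij_betw_byWitness[where f' = "\<lambda>K. (K, {{}})"])
      (auto simp: restrict_operad_def substitution_operad_def rel_empty_face_iff)
next
  fix n \<sigma> and x :: "nat set set \<times> nat set set"
  show "oact substitution_operad n \<sigma> (fst x) = fst (oact (restrict_operad relscpx_operad rel_empty_face) n \<sigma> x)"
    by (cases x) (simp add: restrict_operad_def substitution_operad_def relscpx_operad_simps)
next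
  show "ounit substitution_operad = fst (ounit (restrict_operad relscpx_operad rel_empty_face))"
    by (simp add: restrict_operad_def substitution_operad_def relscpx_operad_simps)
qed

lemma operad_iso_composition:
  "operad_iso (restrict_operad relscpx_operad rel_in_simplex) composition_operad (\<lambda>n. snd)"
proof (rule operad_iso_of_bijection)
  show "operad (restrict_operad relscpx_operad rel_in_simplex)"
    by (rule operad_restrict_suboperad[OF suboperad_rel_in_simplex])
next
  fix n m k :: nat and x y
  assume a: "n \<ge> 1" "m \<ge> 1" "k \<in> {1..n}"
    "x \<in> elts (restrict_operad relscpx_operad rel_in_simplex) n"
    "y \<in> elts (restrict_operad relscpx_operad rel_in_simplex) m"
  then have x: "x \<in> rel_in_simplex n" and y: "y \<in> rel_in_simplex m"
    by (simp_all add: restrict_operad_def)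
  from x obtain L where e1: "x = (full_simplex n, L)" and x': "x \<in> relscpx n"
    by (auto simp: rel_in_simplex_def)
  from y obtain N where e2: "y = (full_simplex m, N)" and N: "N \<noteq> {}" and y': "y \<in> relscpx m"
    by (auto simp: rel_in_simplex_def)
  note e = e1 e2 and xy = x' y'
  have "L \<in> scpx n" "(full_simplex m, N) \<in> relscpx m"
    using xy unfolding e by (simp_all add: relscpx_def)
  then have "rel_subst n m k L (full_simplex m, N) = scpx_comp m k L N"
    using rel_subst_full_simplex_right[OF a(3,2)] N by blast
  then show "ocomp composition_operad n m k (snd x) (snd y)
    = snd (ocomp (restrict_operad relscpx_operad rel_in_simplex) n m k x y)"
    by (simp add: e restrict_operad_def composition_operad_def relscpx_operad_simps)
next
  fix n :: nat
  show "bij_betw snd (elts (restrict_operad relscpx_operad rel_in_simplex) n) (elts composition_operad n)"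
    by (rule bij_betw_byWitness[where f' = "\<lambda>L. (full_simplex n, L)"])
      (auto simp: restrict_operad_def composition_operad_def rel_in_simplex_iff)
next
  fix n \<sigma> and x :: "nat set set \<times> nat set set"
  show "oact composition_operad n \<sigma> (snd x) = snd (oact (restrict_operad relscpx_operad rel_in_simplex) n \<sigma> x)"
    by (cases x) (simp add: restrict_operad_def composition_operad_def relscpx_operad_simps)
next
  show "ounit composition_operad = snd (ounit (restrict_operad relscpx_operad rel_in_simplex))"
    by (simp add: restrict_operad_def composition_operad_def relscpx_operad_simps)
qed

text \<open>
  In both cases the suboperad condition is the computation of the constant component of a composite, and
  the isomorphism is the computation of the other one.
\<close>

theorem proposition4p14:
  "(suboperad relscpx_operad rel_empty_face
    \<and> operad_iso (restrict_operad relscpx_operad rel_empty_face) substitution_operad (\<lambda>n. fst))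
   \<and>
   (suboperad relscpx_operad rel_in_simplex
    \<and> operad_iso (restrict_operad relscpx_operad rel_in_simplex) composition_operad (\<lambda>n. snd))"
  using suboperad_rel_empty_face operad_iso_substitution
    suboperad_rel_in_simplex operad_iso_composition by blast

end
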